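(* A non-empty closed set $C\subseteq 2^\omega$ is a random closed set if and only if $C$ is the $1/3$-support of some random measure $\mu\in\mathscr{P}(2^\omega)$.
   Context: $\lambda$ denotes the uniform measure on $2^\omega$, $\lambda_3$ the uniform measure on $3^\omega$; Martin-Löf randomness of $x\in n^\omega$ is with respect to the uniform measure $\lambda_n$: $x$ is Martin-Löf random if $x\notin\bigcap_iU_i$ for every uniformly $\Sigma^0_1$ sequence $(U_i)$ of open sets with $\lambda_n(U_i)\le2^{-i}$. Random measures: fix a computable bijection $\langle\cdot,\cdot\rangle:\omega^2\to\omega$. For $x\in2^\omega$ let its $n$-th column be $x_n\in2^\omega$, $x_n(k)=x(\langle n,k\rangle)$, identified with the real number $\sum_k x_n(k)2^{-(k+1)}\in[0,1]$. Let $\sigma_0=\epsilon,\sigma_1=0,\sigma_2=1,\dots$ be the length-lexicographic enumeration of $2^{<\omega}$. Then $\mu_x$ is the unique Borel probability measure on $2^\omega$ with $\mu_x(\llbracket\sigma_n0\rrbracket)=x_n\cdot\mu_x(\llbracket\sigma_n\rrbracket)$ for all $n$. A measure $\mu$ is a random measure if $\mu=\mu_x$ for some Martin-Löf random $x\in2^\omega$. For a measure $\mu$ and strings $\rho\preceq\tau$, $\mu(\tau\mid\rho)=\mu(\llbracket\tau\rrbracket)/\mu(\llbracket\rho\rrbracket)$. Define $T_\mu=\{\sigma\in2^{<\omega}:(\forall i<|\sigma|)\ \mu(\sigma\restriction(i+1)\mid\sigma\restriction i)>1/3\}\cup\{\epsilon\}$; the $1/3$-support of $\mu$ is the closed set $[T_\mu]$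 of infinite paths through $T_\mu$. Random closed sets: for $x\in 3^\omega$ the tree $T_x$ is defined by $\epsilon\in T_x$ and, if $\sigma$ is the $(i+1)$-st node of $T_x$ (length-lexicographic order), $\sigma0\in T_x,\sigma1\notin T_x$ if $x(i)=0$; $\sigma0\notin T_x,\sigma1\in T_x$ if $x(i)=1$; both if $x(i)=2$. $C$ is a random closed set if $C=[T_x]$ for some Martin-Löf random $x\in3^\omega$. *)

theory Defs
  imports "HOL-Probability.Probability" "HOL-Library.Nat_Bijection"
begin

inductive PR :: "nat \<Rightarrow> (nat list \<Rightarrow> nat) \<Rightarrow> bool" where
  PR_zero: "PR n (\<lambda>_. 0)"
| PR_succ: "PR 1 (\<lambda>xs. Suc (hd xs))"
| PR_proj: "i < n \<Longrightarrow> PR n (\<lambda>xs. xs ! i)"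
| PR_comp: "PR m f \<Longrightarrow> length gs = m \<Longrightarrow> (\<forall>g\<in>set gs. PR n g) \<Longrightarrow>
            PR n (\<lambda>xs. f (map (\<lambda>g. g xs) gs))"
| PR_rec: "PR n f \<Longrightarrow> PR (Suc (Suc n)) g \<Longrightarrow>
           PR (Suc n) (\<lambda>xs. rec_nat (f (tl xs)) (\<lambda>y r. g (y # r # tl xs)) (hd xs))"

text \<open>Sigma01 (computably enumerable) sets of naturals, via Kleene normal form:
the projection of a primitive recursive relation.\<close>
definition sigma01 :: "nat set \<Rightarrow> bool" where
  "sigma01 A \<longleftrightarrow> (\<exists>f. PR 2 f \<and> (\<forall>a. a \<in> A \<longleftrightarrow> (\<exists>b. f [a, b] = 0)))"

definition seqs :: "nat \<Rightarrow> (nat \<Rightarrow> nat) set" where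
  "seqs n = {x. \<forall>i. x i < n}"

definition cyl :: "nat list \<Rightarrow> (nat \<Rightarrow> nat) set" where
  "cyl \<sigma> = {y. \<forall>i<length \<sigma>. y i = \<sigma> ! i}"

definition unif :: "nat \<Rightarrow> (nat \<Rightarrow> nat) measure" where
  "unif n = PiM UNIV (\<lambda>_. measure_pmf (pmf_of_set {..<n}))"

text \<open>Uniformly Sigma01 sequence of open sets given by a c.e. set W of codes
  prod_encode (i, list_encode sigma); U_i is the union of the cylinders of the sigma's.\<close>
definition test_set :: "nat set \<Rightarrow> nat \<Rightarrow> (nat \<Rightarrow> nat) set" where
  "test_set W i = \<Union>{cyl \<sigma> | \<sigma>. prod_encode (i, list_encode \<sigma>) \<in> W}"

definition martin_loef_test :: "nat \<Rightarrow> nat set \<Rightarrow> bool" where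
  "martin_loef_test n W \<longleftrightarrow> sigma01 W \<and>
     (\<forall>i. emeasure (unif n) (test_set W i) \<le> ennreal (1 / 2 ^ i))"

definition martin_loef_random :: "nat \<Rightarrow> (nat \<Rightarrow> nat) \<Rightarrow> bool" where
  "martin_loef_random n x \<longleftrightarrow> x \<in> seqs n \<and> (\<forall>W. martin_loef_test n W \<longrightarrow> x \<notin> (\<Inter>i. test_set W i))"

definition col :: "(nat \<Rightarrow> nat) \<Rightarrow> nat \<Rightarrow> real" where
  "col x n = (\<Sum>k. real (x (prod_encode (n, k))) / 2 ^ (Suc k))"

text \<open>Index of a binary string in the length-lexicographic enumeration
  sigma_0 = empty, sigma_1 = 0, sigma_2 = 1, sigma_3 = 00, ...\<close>
definition str_index :: "nat list \<Rightarrow> nat" where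
  "str_index \<sigma> = (\<Sum>i<length \<sigma>. \<sigma> ! i * 2 ^ (length \<sigma> - Suc i)) + 2 ^ length \<sigma> - 1"

text \<open>mu_x on cylinders: mu_x [empty] = 1 and mu_x [sigma_n 0] = x_n * mu_x [sigma_n],
  mu_x [sigma_n 1] = (1 - x_n) * mu_x [sigma_n]; this determines the measure mu_x.\<close>
definition mu :: "(nat \<Rightarrow> nat) \<Rightarrow> nat list \<Rightarrow> real" where
  "mu x \<sigma> = (\<Prod>i<length \<sigma>. (let c = col x (str_index (take i \<sigma>))
                                in if \<sigma> ! i = 0 then c else 1 - c))"

definition cond :: "(nat list \<Rightarrow> real) \<Rightarrow> nat list \<Rightarrow> nat list \<Rightarrow> real" where
  "cond m \<tau> \<rho> = m \<tau> / m \<rho>"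

definition binstr :: "nat list \<Rightarrow> bool" where
  "binstr \<sigma> \<longleftrightarrow> (\<forall>b\<in>set \<sigma>. b < 2)"

definition T_meas :: "(nat list \<Rightarrow> real) \<Rightarrow> nat list set" where
  "T_meas m = {\<sigma>. binstr \<sigma> \<and> (\<forall>i<length \<sigma>. cond m (take (Suc i) \<sigma>) (take i \<sigma>) > 1/3)} \<union> {[]}"

definition paths :: "nat list set \<Rightarrow> (nat \<Rightarrow> nat) set" where
  "paths T = {y \<in> seqs 2. \<forall>k. map y [0..<k] \<in> T}"

definition third_support :: "(nat list \<Rightarrow> real) \<Rightarrow> (nat \<Rightarrow> nat) set" where
  "third_support m = paths (T_meas m)"

definition random_measure_support :: "(nat \<Rightarrow> nat) set \<Rightarrow> bool" where
  "random_measure_support C \<longleftrightarrow> (\<exists>x. martin_loef_random 2 x \<and> C = third_support (mu x))"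

definition kids :: "nat \<Rightarrow> nat list \<Rightarrow> nat list list" where
  "kids d \<sigma> = (if d = 0 then [\<sigma> @ [0]] else if d = 1 then [\<sigma> @ [1]] else [\<sigma> @ [0], \<sigma> @ [1]])"

text \<open>lev x k = (list of the nodes of T_x of length k in lexicographic order,
  number of nodes of T_x of length < k).  The (off+j+1)-st node of T_x in
  length-lexicographic order is the j-th node of level k, and its children are
  determined by x (off + j).\<close>
fun lev :: "(nat \<Rightarrow> nat) \<Rightarrow> nat \<Rightarrow> nat list list \<times> nat" where
  "lev x 0 = ([[]], 0)"
| "lev x (Suc k) = (let (L, off) = lev x k in
     (concat (map (\<lambda>j. kids (x (off + j)) (L ! j)) [0..<length L]), off + length L))"

definition tree3 :: "(nat \<Rightarrow> nat) \<Rightarrow> nat list set" where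
  "tree3 x = (\<Union>k. set (fst (lev x k)))"

definition random_closed :: "(nat \<Rightarrow> nat) set \<Rightarrow> bool" where
  "random_closed C \<longleftrightarrow> (\<exists>x. martin_loef_random 3 x \<and> C = paths (tree3 x))"

end

theory Submission
  imports Defs
begin

text \<open>A column of \<open>x\<close> lies below 1/3, between 1/3 and 2/3, or above 2/3, each with probability 1/3, and this
  is decided by finitely many bits unless the column is one of the two expansions of 1/3 and 2/3.
  Reading off these labels along the nodes of the 1/3-support, in breadth-first order, gives a
  partial computable map from \<open>x\<close> to a code \<open>z\<close> of the same tree. Distinct nodes use distinct,
  hence independent, columns, so the map is measure preserving, and randomness of \<open>x\<close> passes to \<open>z\<close>
  by pulling tests back.

  Conversely let \<open>z\<close> be random. For a test \<open>U\<close> on the bits, the conditional measure of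
  \<open>U (2 i)\<close> given that the image extends \<open>\<tau>\<close> is a martingale in \<open>\<tau>\<close>, so by Ville's inequality the
  strings where it exceeds \<open>2 ^ -i\<close> form a test, which \<open>z\<close> passes. There are only countably many tests,
  so levels can be chosen for all of them at once such that the union of these levels fills at most
  half of every set of sequences whose image extends a prefix of \<open>z\<close>. By compactness some \<open>x\<close> outside
  the union is a limit of such sequences; it is random, and by continuity it is mapped to \<open>z\<close>.\<close>

section \<open>Computable functions and semidecidable predicates\<close>

text \<open>The set of inputs whose image extends \<tau> is open but in general not closed, since a
  column may stay undecided in the limit. A limit of inputs whose images extend longer and longer
  prefixes of \<open>z\<close> could therefore leave the domain of the map. This is why randomness
  of the limit is secured before its image is known: a random input has no column that alternates
  forever, so it does have an image, and only then does continuity identify this image with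
  \<open>z\<close>. The fibre over \<open>z\<close> is a null set, so small measure of a test level
  says nothing about the fibre directly. What is controlled is the share that the level fills of
  each set of inputs with image extending a prefix of \<open>z\<close>, by a bound that is the same
  for all prefixes. The index \<open>2 i\<close> pays for Ville's inequality, which loses a factor
  \<open>2 ^ i\<close>. The levels may be chosen noncomputably, as only the existence of
  \<open>x\<close> is claimed.\<close>

definition prn :: "nat \<Rightarrow> (nat list \<Rightarrow> nat) \<Rightarrow> bool" where
  "prn n h \<longleftrightarrow> (\<exists>f. PR n f \<and> (\<forall>xs. length xs = n \<longrightarrow> f xs = h xs))"

text \<open>\<open>PR\<close> functions also take values on lists of the wrong length, and these are
  accidental. Comparing on lists of length \<open>n\<close> only is what makes rewriting
  possible.\<close>

lemma prn_cong:
  assumes "prn n f" "\<And>xs. length xs = n \<Longrightarrow> f xs = g xs"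
  shows "prn n g"
  using assms unfolding prn_def by metis

lemma prn_proj: "i < n \<Longrightarrow> prn n (\<lambda>xs. xs ! i)"
  unfolding prn_def using PR_proj by blast

lemma prn_comp:
  assumes "prn (length gs) f" "\<forall>g\<in>set gs. prn n g"
  shows "prn n (\<lambda>xs. f (map (\<lambda>g. g xs) gs))"
proof -
  obtain f' where f': "PR (length gs) f'" "\<And>xs. length xs = length gs \<Longrightarrow> f' xs = f xs"
    using assms(1) unfolding prn_def by blast
  obtain c where c: "\<And>g. g \<in> set gs \<Longrightarrow> PR n (c g) \<and> (\<forall>xs. length xs = n \<longrightarrow> c g xs = g xs)"
    using assms(2) unfolding prn_def by metis
  have "PR n (\<lambda>xs. f' (map (\<lambda>g. g xs) (map c gs)))"
    using f'(1) c by (intro PR_comp[where m = "length gs"]) auto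
  moreover have "f' (map (\<lambda>g. g xs) (map c gs)) = f (map (\<lambda>g. g xs) gs)" if "length xs = n" for xs
  proof -
    have "map (\<lambda>g. g xs) (map c gs) = map (\<lambda>g. g xs) gs"
      using c that by (simp add: comp_def)
    then show ?thesis by (simp only: f'(2) length_map)
  qed
  ultimately show ?thesis unfolding prn_def by blast
qed

lemma prn_comp1: "prn 1 (\<lambda>ys. f (ys ! 0)) \<Longrightarrow> prn n g \<Longrightarrow> prn n (\<lambda>xs. f (g xs))"
  using prn_comp[of "[g]" "\<lambda>ys. f (ys ! 0)" n] by simp

lemma prn_comp2:
  "prn 2 (\<lambda>ys. f (ys ! 0) (ys ! 1)) \<Longrightarrow> prn n g \<Longrightarrow> prn n h \<Longrightarrow> prn n (\<lambda>xs. f (g xs) (h xs))"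
  using prn_comp[of "[g, h]" "\<lambda>ys. f (ys ! 0) (ys ! 1)" n] by (simp add: numeral_2_eq_2)

lemma prn_Suc: "prn n g \<Longrightarrow> prn n (\<lambda>xs. Suc (g xs))"
proof (rule prn_comp1[where f = Suc])
  show "prn 1 (\<lambda>ys. Suc (ys ! 0))"
    unfolding prn_def using PR_succ by (metis hd_conv_nth length_0_conv zero_neq_one)
qed

lemma prn_const: "prn n (\<lambda>xs. c)"
proof (induction c)
  case 0
  show ?case unfolding prn_def using PR_zero by blast
next
  case (Suc c)
  then show ?case by (rule prn_Suc)
qed

lemma prn_rec_aux:
  assumes "prn n f" "prn (Suc (Suc n)) g"
  shows "prn (Suc n) (\<lambda>xs. rec_nat (f (tl xs)) (\<lambda>y r. g (y # r # tl xs)) (hd xs))"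
proof -
  obtain f' where f': "PR n f'" "\<And>xs. length xs = n \<Longrightarrow> f' xs = f xs"
    using assms(1) unfolding prn_def by blast
  obtain g' where g': "PR (Suc (Suc n)) g'" "\<And>xs. length xs = Suc (Suc n) \<Longrightarrow> g' xs = g xs"
    using assms(2) unfolding prn_def by blast
  have "rec_nat (f' (tl xs)) (\<lambda>y r. g' (y # r # tl xs)) (hd xs) =
        rec_nat (f (tl xs)) (\<lambda>y r. g (y # r # tl xs)) (hd xs)" if "length xs = Suc n" for xs
    using that f'(2) g'(2) by simp
  then show ?thesis unfolding prn_def using PR_rec[OF f'(1) g'(1)] by blast
qed

text \<open>\<open>PR_rec\<close> recurses on the first argument and hands on the tail. Prepending
  the bound \<open>N\<close> to the list of all projections turns this into recursion up to an
  arbitrary function of the parameters.\<close>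

lemma prn_rec:
  assumes N: "prn n N" and f: "prn n f"
    and g: "prn (Suc (Suc n)) (\<lambda>xs. g (xs ! 0) (xs ! 1) (drop 2 xs))"
  shows "prn n (\<lambda>xs. rec_nat (f xs) (\<lambda>y r. g y r xs) (N xs))"
proof -
  let ?h = "\<lambda>xs. rec_nat (f (tl xs)) (\<lambda>y r. g y r (tl xs)) (hd xs)"
  have h: "prn (Suc n) ?h"
    using prn_rec_aux[OF f g] by simp
  let ?gs = "N # map (\<lambda>i xs. xs ! i) [0..<n]"
  have "prn n (\<lambda>xs. ?h (map (\<lambda>g. g xs) ?gs))"
    using h N by (intro prn_comp) (auto intro: prn_proj)
  then show ?thesis
  proof (rule prn_cong)
    fix xs :: "nat list" assume "length xs = n"
    then have "map (\<lambda>g. g xs) (map (\<lambda>i xs. xs ! i) [0..<n]) = xs"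
      by (auto simp: comp_def map_nth)
    then show "?h (map (\<lambda>g. g xs) ?gs) = rec_nat (f xs) (\<lambda>y r. g y r xs) (N xs)"
      by simp
  qed
qed

lemma prn_add: "prn n f \<Longrightarrow> prn n g \<Longrightarrow> prn n (\<lambda>xs. f xs + g xs)"
proof (rule prn_comp2[where f = "(+)"])
  have "prn 2 (\<lambda>ys. rec_nat (ys ! 1) (\<lambda>y r. Suc r) (ys ! 0))"
    by (intro prn_rec prn_proj prn_Suc) auto
  moreover have "rec_nat b (\<lambda>y r. Suc r) a = a + b" for a b
    by (induction a) auto
  ultimately show "prn 2 (\<lambda>ys. ys ! 0 + ys ! 1)" by simp
qed

lemma prn_mult: "prn n f \<Longrightarrow> prn n g \<Longrightarrow> prn n (\<lambda>xs. f xs * g xs)"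
proof (rule prn_comp2[where f = times])
  have "prn 2 (\<lambda>ys. rec_nat 0 (\<lambda>y r. r + ys ! 1) (ys ! 0))"
    by (intro prn_rec prn_proj prn_add prn_const) (auto intro!: prn_cong[OF prn_proj[of 3]])
  moreover have "rec_nat 0 (\<lambda>y r. r + b) a = a * b" for a b :: nat
    by (induction a) auto
  ultimately show "prn 2 (\<lambda>ys. ys ! 0 * ys ! 1)" by simp
qed

lemma prn_pred: "prn n f \<Longrightarrow> prn n (\<lambda>xs. f xs - 1)"
proof (rule prn_comp1[where f = "\<lambda>k. k - 1"])
  have "prn 1 (\<lambda>ys. rec_nat 0 (\<lambda>y r. y) (ys ! 0))"
    by (intro prn_rec prn_proj prn_const) auto
  moreover have "rec_nat 0 (\<lambda>y r. y) a = a - 1" for a :: nat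
    by (cases a) auto
  ultimately show "prn 1 (\<lambda>ys. ys ! 0 - 1)" by simp
qed

lemma prn_diff: "prn n f \<Longrightarrow> prn n g \<Longrightarrow> prn n (\<lambda>xs. f xs - g xs)"
proof (rule prn_comp2[where f = "(-)"])
  have "prn 2 (\<lambda>ys. rec_nat (ys ! 0) (\<lambda>y r. r - 1) (ys ! 1))"
    by (intro prn_rec prn_proj prn_pred) auto
  moreover have "rec_nat a (\<lambda>y r. r - 1) b = a - b" for a b :: nat
    by (induction b) auto
  ultimately show "prn 2 (\<lambda>ys. ys ! 0 - ys ! 1)" by simp
qed

lemma prn_if_le:
  assumes "prn n a" "prn n b" "prn n u" "prn n v"
  shows "prn n (\<lambda>xs. if a xs \<le> b xs then u xs else v xs)"
proof -
  have "prn n (\<lambda>xs. u xs * (1 - (a xs - b xs)) + v xs * (1 - (1 - (a xs - b xs))))"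
    by (intro prn_add prn_mult prn_diff prn_const assms)
  then show ?thesis by (rule prn_cong) auto
qed

lemma prn_triangle: "prn n f \<Longrightarrow> prn n (\<lambda>xs. triangle (f xs))"
proof (rule prn_comp1[where f = triangle])
  have "prn 1 (\<lambda>ys. rec_nat 0 (\<lambda>y r. r + Suc y) (ys ! 0))"
    by (intro prn_rec prn_proj prn_const prn_add prn_Suc) auto
  moreover have "rec_nat 0 (\<lambda>y r. r + Suc y) a = triangle a" for a :: nat
    by (induction a) auto
  ultimately show "prn 1 (\<lambda>ys. triangle (ys ! 0))" by simp
qed

text \<open>The number of the Cantor diagonal on which \<open>k\<close> lies, that is, the greatest
  \<open>d\<close> with \<open>triangle d\<close> at most \<open>k\<close>. From \<open>y\<close> to
  \<open>Suc y\<close> it grows by at most one, so primitive recursion finds it, and decoding a pair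
  becomes subtraction.\<close>

definition diag :: "nat \<Rightarrow> nat" where
  "diag = rec_nat 0 (\<lambda>y r. if triangle (Suc r) \<le> Suc y then Suc r else r)"

lemma prn_diag: "prn n f \<Longrightarrow> prn n (\<lambda>xs. diag (f xs))"
proof (rule prn_comp1[where f = diag])
  show "prn 1 (\<lambda>ys. diag (ys ! 0))"
    unfolding diag_def
    by (intro prn_rec prn_proj prn_const prn_if_le prn_triangle prn_Suc) auto
qed

lemma diag_bounds: "triangle (diag k) \<le> k \<and> k < triangle (Suc (diag k))"
  by (induction k) (auto simp: diag_def)

lemma triangle_mono: "a \<le> b \<Longrightarrow> triangle a \<le> triangle b"
  by (rule lift_Suc_mono_le[of triangle]) auto

lemma diag_prod_encode: "diag (prod_encode (a, b)) = a + b"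
proof -
  let ?k = "prod_encode (a, b)"
  have "triangle (a + b) \<le> ?k" "?k < triangle (Suc (a + b))"
    by (auto simp: prod_encode_def)
  moreover have "triangle (diag ?k) \<le> ?k" "?k < triangle (Suc (diag ?k))"
    using diag_bounds by auto
  ultimately have "\<not> Suc (diag ?k) \<le> a + b" "\<not> Suc (a + b) \<le> diag ?k"
    using triangle_mono[of "Suc (diag ?k)" "a + b"] triangle_mono[of "Suc (a + b)" "diag ?k"]
    by linarith+
  then show ?thesis by simp
qed

lemma prod_decode_diag:
  "fst (prod_decode k) = k - triangle (diag k)"
  "snd (prod_decode k) = diag k - (k - triangle (diag k))"
proof -
  obtain a b where ab: "prod_decode k = (a, b)" by fastforce
  then have k: "k = prod_encode (a, b)" by (metis prod_decode_inverse)
  have "k - triangle (diag k) = a"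
    using diag_prod_encode[of a b] k by (simp add: prod_encode_def)
  moreover have "diag k = a + b" using diag_prod_encode k by simp
  ultimately show "fst (prod_decode k) = k - triangle (diag k)"
    "snd (prod_decode k) = diag k - (k - triangle (diag k))"
    using ab by auto
qed

lemma prn_fst_decode: "prn n f \<Longrightarrow> prn n (\<lambda>xs. fst (prod_decode (f xs)))"
  unfolding prod_decode_diag by (intro prn_diff prn_triangle prn_diag)

lemma prn_snd_decode: "prn n f \<Longrightarrow> prn n (\<lambda>xs. snd (prod_decode (f xs)))"
  unfolding prod_decode_diag by (intro prn_diff prn_triangle prn_diag)

lemma prn_prod_encode: "prn n f \<Longrightarrow> prn n g \<Longrightarrow> prn n (\<lambda>xs. prod_encode (f xs, g xs))"
  unfolding prod_encode_def by (simp, intro prn_add prn_triangle)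

text \<open>Codings are bijective, so that an existential quantifier over a coded type is one over the naturals.\<close>

class coded =
  fixes enc :: "'a \<Rightarrow> nat"
  assumes bij_enc: "bij enc"

definition dec :: "nat \<Rightarrow> 'a::coded" where "dec = inv enc"

lemma dec_enc [simp]: "dec (enc a) = a"
  unfolding dec_def by (simp add: bij_enc bij_is_inj)

lemma enc_dec [simp]: "enc (dec n :: 'a::coded) = n"
  unfolding dec_def by (simp add: bij_enc bij_is_surj surj_f_inv_f)

lemma enc_eq_iff [simp]: "enc a = enc b \<longleftrightarrow> a = b"
  by (metis dec_enc)

instantiation nat :: coded
begin
definition enc_nat :: "nat \<Rightarrow> nat" where "enc_nat n = n"
instance by standard (auto simp: enc_nat_def bij_def inj_def surj_def)
end

instantiation prod :: (coded, coded) coded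
begin
definition enc_prod :: "'a \<times> 'b \<Rightarrow> nat" where
  "enc_prod p = prod_encode (enc (fst p), enc (snd p))"
instance
proof
  have "\<exists>p :: 'a \<times> 'b. n = enc p" for n
    by (rule exI[of _ "(dec (fst (prod_decode n)), dec (snd (prod_decode n)))"])
      (simp add: enc_prod_def)
  then show "bij (enc :: 'a \<times> 'b \<Rightarrow> nat)"
    by (auto simp: bij_def inj_def surj_def enc_prod_def)
qed
end

instantiation list :: (coded) coded
begin
definition enc_list :: "'a list \<Rightarrow> nat" where
  "enc_list xs = list_encode (map enc xs)"
instance
proof
  have "\<exists>xs :: 'a list. n = enc xs" for n
    by (rule exI[of _ "map dec (list_decode n)"]) (simp add: enc_list_def comp_def)
  moreover have "inj (enc :: 'a list \<Rightarrow> nat)"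
    by (auto simp: inj_def enc_list_def list_encode_eq inj_map_eq_map[OF bij_is_inj[OF bij_enc]])
  ultimately show "bij (enc :: 'a list \<Rightarrow> nat)"
    by (auto simp: bij_def surj_def)
qed
end

lemma enc_list_Nil [simp]: "enc [] = 0"
  by (simp add: enc_list_def)

lemma enc_list_Cons [simp]: "enc (x # xs) = Suc (prod_encode (enc x, enc xs))"
  by (simp add: enc_list_def)

lemma enc_nat_list: "enc (xs :: nat list) = list_encode xs"
  by (simp add: enc_list_def enc_nat_def[abs_def])

section \<open>Computable maps between coded types\<close>

definition unary_pr :: "(nat \<Rightarrow> nat) \<Rightarrow> bool" where
  "unary_pr g \<longleftrightarrow> prn 1 (\<lambda>xs. g (xs ! 0))"

lemma unary_pr_id: "unary_pr (\<lambda>k. k)"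
  unfolding unary_pr_def by (rule prn_proj) simp

lemma unary_pr_comp: "unary_pr f \<Longrightarrow> unary_pr g \<Longrightarrow> unary_pr (\<lambda>k. f (g k))"
  unfolding unary_pr_def by (rule prn_comp1)

lemma unary_pr_intros:
  "unary_pr (\<lambda>k. c)"
  "unary_pr f \<Longrightarrow> unary_pr (\<lambda>k. Suc (f k))"
  "unary_pr f \<Longrightarrow> unary_pr (\<lambda>k. f k - 1)"
  "unary_pr f \<Longrightarrow> unary_pr g \<Longrightarrow> unary_pr (\<lambda>k. f k + g k)"
  "unary_pr f \<Longrightarrow> unary_pr g \<Longrightarrow> unary_pr (\<lambda>k. f k * g k)"
  "unary_pr f \<Longrightarrow> unary_pr g \<Longrightarrow> unary_pr (\<lambda>k. f k - g k)"
  "unary_pr f \<Longrightarrow> unary_pr g \<Longrightarrow> unary_pr (\<lambda>k. prod_encode (f k, g k))"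
  "unary_pr f \<Longrightarrow> unary_pr (\<lambda>k. fst (prod_decode (f k)))"
  "unary_pr f \<Longrightarrow> unary_pr (\<lambda>k. snd (prod_decode (f k)))"
  unfolding unary_pr_def
  by (fact prn_const prn_Suc prn_pred prn_add prn_mult prn_diff prn_prod_encode
      prn_fst_decode prn_snd_decode)+

text \<open>Despite the name, primitive recursive on codes. This is enough because unbounded search
  is left to the existential quantifier of \<open>semidec\<close>, as in Kleene normal form.\<close>

definition computable :: "('a::coded \<Rightarrow> 'b::coded) \<Rightarrow> bool" where
  "computable f \<longleftrightarrow> (\<exists>g. unary_pr g \<and> (\<forall>a. enc (f a) = g (enc a)))"

lemma computableI:
  "unary_pr g \<Longrightarrow> (\<And>a. enc (f a) = g (enc a)) \<Longrightarrow> computable f"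
  unfolding computable_def by blast

lemma computable_comp:
  assumes "computable f" "computable g"
  shows "computable (\<lambda>a. f (g a))"
proof -
  obtain f' where f': "unary_pr f'" "\<And>a. enc (f a) = f' (enc a)"
    using assms(1) unfolding computable_def by blast
  obtain g' where g': "unary_pr g'" "\<And>a. enc (g a) = g' (enc a)"
    using assms(2) unfolding computable_def by blast
  show ?thesis
    by (rule computableI[OF unary_pr_comp[OF f'(1) g'(1)]]) (simp add: f' g')
qed

lemma computable_id: "computable (\<lambda>a. a)"
  by (rule computableI[OF unary_pr_id]) simp

lemma computable_const: "computable (\<lambda>a. c)"
  by (rule computableI[OF unary_pr_intros(1)]) simp

lemma computable_dec: "computable (dec :: nat \<Rightarrow> 'a::coded)"
  by (rule computableI[OF unary_pr_id]) (simp add: enc_nat_def)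

lemma computable_enc: "computable f \<Longrightarrow> computable (\<lambda>a. enc (f a))"
  by (rule computable_comp[where f = enc], rule computableI[OF unary_pr_id])
    (simp_all add: enc_nat_def)

lemma computable_fst: "computable f \<Longrightarrow> computable (\<lambda>a. fst (f a))"
  by (rule computable_comp[where f = fst], rule computableI[OF unary_pr_intros(8)[OF unary_pr_id]])
    (simp_all add: enc_prod_def)

lemma computable_snd: "computable f \<Longrightarrow> computable (\<lambda>a. snd (f a))"
  by (rule computable_comp[where f = snd], rule computableI[OF unary_pr_intros(9)[OF unary_pr_id]])
    (simp_all add: enc_prod_def)

lemma computable_o_fst: "computable f \<Longrightarrow> computable (\<lambda>p. f (fst p))"
  by (rule computable_comp[OF _ computable_fst[OF computable_id]])

lemma computable_Pair:
  assumes "computable f" "computable g"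
  shows "computable (\<lambda>a. (f a, g a))"
proof -
  obtain f' where f': "unary_pr f'" "\<And>a. enc (f a) = f' (enc a)"
    using assms(1) unfolding computable_def by blast
  obtain g' where g': "unary_pr g'" "\<And>a. enc (g a) = g' (enc a)"
    using assms(2) unfolding computable_def by blast
  show ?thesis
    by (rule computableI[OF unary_pr_intros(7)[OF f'(1) g'(1)]]) (simp add: f' g' enc_prod_def)
qed

lemma computable_comp2:
  "computable (\<lambda>p. f (fst p) (snd p)) \<Longrightarrow> computable g \<Longrightarrow> computable h \<Longrightarrow>
    computable (\<lambda>a. f (g a) (h a))"
  using computable_comp[of "\<lambda>p. f (fst p) (snd p)" "\<lambda>a. (g a, h a)"] computable_Pair by auto

lemma computable_Suc: "computable f \<Longrightarrow> computable (\<lambda>a. Suc (f a))"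
  by (rule computable_comp[where f = Suc], rule computableI[OF unary_pr_intros(2)[OF unary_pr_id]])
    (simp_all add: enc_nat_def)

lemma computable_add: "computable f \<Longrightarrow> computable g \<Longrightarrow> computable (\<lambda>a. f a + g a :: nat)"
  by (rule computable_comp2[where f = "(+)"], rule computableI[OF unary_pr_intros(4)[OF
          unary_pr_intros(8)[OF unary_pr_id] unary_pr_intros(9)[OF unary_pr_id]]])
    (simp_all add: enc_nat_def enc_prod_def)

lemma computable_mult: "computable f \<Longrightarrow> computable g \<Longrightarrow> computable (\<lambda>a. f a * g a :: nat)"
  by (rule computable_comp2[where f = times], rule computableI[OF unary_pr_intros(5)[OF
          unary_pr_intros(8)[OF unary_pr_id] unary_pr_intros(9)[OF unary_pr_id]]])
    (simp_all add: enc_nat_def enc_prod_def)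

lemma computable_diff: "computable f \<Longrightarrow> computable g \<Longrightarrow> computable (\<lambda>a. f a - g a :: nat)"
  by (rule computable_comp2[where f = "(-)"], rule computableI[OF unary_pr_intros(6)[OF
          unary_pr_intros(8)[OF unary_pr_id] unary_pr_intros(9)[OF unary_pr_id]]])
    (simp_all add: enc_nat_def enc_prod_def)

lemma computable_rec:
  assumes N: "computable N" and f: "computable f"
    and g: "computable (\<lambda>p. g (fst p) (fst (snd p)) (snd (snd p)))"
  shows "computable (\<lambda>a. rec_nat (f a) (g a) (N a))"
proof -
  obtain N' where N': "unary_pr N'" "\<And>a. N a = N' (enc a)"
    using N unfolding computable_def enc_nat_def by blast
  obtain f' where f': "unary_pr f'" "\<And>a. enc (f a) = f' (enc a)"
    using f unfolding computable_def by blast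
  obtain g' where "unary_pr g'" and
    "\<And>p. enc (g (fst p) (fst (snd p)) (snd (snd p))) = g' (enc p)"
    using g unfolding computable_def by blast
  then have g': "unary_pr g'"
    "\<And>a i r. enc (g a i r) = g' (prod_encode (enc a, prod_encode (i, enc r)))"
    by (auto simp: enc_prod_def enc_nat_def)
  let ?h = "\<lambda>n. rec_nat (f' n) (\<lambda>y r. g' (prod_encode (n, prod_encode (y, r)))) (N' n)"
  show ?thesis
  proof (rule computableI)
    \<comment> \<open>\<open>prn_rec\<close> supplies the counter, the previous value and then the
      parameters, so the code of the argument is entry 2.\<close>
    have "prn 3 (\<lambda>xs. g' (prod_encode (xs ! 2, prod_encode (xs ! 0, xs ! 1))))"
      using g'(1) unfolding unary_pr_def
      by (rule prn_comp1) (intro prn_prod_encode prn_proj; simp)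
    then have "prn (Suc (Suc 1))
        (\<lambda>xs. g' (prod_encode (drop 2 xs ! 0, prod_encode (xs ! 0, xs ! 1))))"
      by (auto simp: numeral_3_eq_3 intro: prn_cong)
    then show "unary_pr ?h"
      using N'(1) f'(1) unfolding unary_pr_def by (intro prn_rec)
    have "enc (rec_nat (f a) (g a) k) =
      rec_nat (f' (enc a)) (\<lambda>y r. g' (prod_encode (enc a, prod_encode (y, r)))) k" for a k
      by (induction k) (auto simp: f' g')
    then show "enc (rec_nat (f a) (g a) (N a)) = ?h (enc a)" for a
      by (simp add: N')
  qed
qed

lemma computable_power: "computable f \<Longrightarrow> computable g \<Longrightarrow> computable (\<lambda>a. f a ^ g a :: nat)"
proof -
  assume fg: "computable f" "computable g"
  have "computable (\<lambda>a. rec_nat 1 (\<lambda>i r. f a * r) (g a))"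
    by (intro computable_rec computable_const computable_mult computable_snd computable_id
        computable_o_fst[OF fg(1)] fg)
  moreover have "rec_nat 1 (\<lambda>i r. b * r) k = b ^ k" for b k :: nat
    by (induction k) auto
  ultimately show ?thesis by simp
qed

section \<open>Decidable predicates and operations on lists\<close>

definition decidable :: "('a::coded \<Rightarrow> bool) \<Rightarrow> bool" where
  "decidable P \<longleftrightarrow> computable (\<lambda>a. of_bool (P a) :: nat)"

lemma decidable_comp: "decidable P \<Longrightarrow> computable f \<Longrightarrow> decidable (\<lambda>a. P (f a))"
  unfolding decidable_def by (rule computable_comp)

lemma decidable_le: "computable f \<Longrightarrow> computable g \<Longrightarrow> decidable (\<lambda>a. f a \<le> (g a :: nat))"
proof -
  assume "computable f" "computable g"
  then have "computable (\<lambda>a. 1 - (f a - g a))"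
    by (intro computable_diff computable_const)
  moreover have "1 - (a - b) = of_bool (a \<le> b)" for a b :: nat by auto
  ultimately show ?thesis unfolding decidable_def by simp
qed

lemma decidable_less: "computable f \<Longrightarrow> computable g \<Longrightarrow> decidable (\<lambda>a. f a < (g a :: nat))"
  using decidable_le[of "\<lambda>a. Suc (f a)" g] computable_Suc by (auto simp: Suc_le_eq)

lemma decidable_not: "decidable P \<Longrightarrow> decidable (\<lambda>a. \<not> P a)"
proof -
  assume "decidable P"
  then have "computable (\<lambda>a. 1 - of_bool (P a) :: nat)"
    unfolding decidable_def by (intro computable_diff computable_const)
  moreover have "1 - of_bool A = (of_bool (\<not> A) :: nat)" for A by auto
  ultimately show ?thesis unfolding decidable_def by simp
qed

lemma decidable_conj: "decidable P \<Longrightarrow> decidable Q \<Longrightarrow> decidable (\<lambda>a. P a \<and> Q a)"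
  unfolding decidable_def of_bool_conj by (rule computable_mult)

lemma decidable_eq: "computable f \<Longrightarrow> computable g \<Longrightarrow> decidable (\<lambda>a. f a = g a)"
proof -
  assume "computable f" "computable g"
  then have "decidable (\<lambda>a. enc (f a) \<le> enc (g a) \<and> enc (g a) \<le> enc (f a))"
    by (intro decidable_conj decidable_le computable_enc)
  moreover have "(enc (f a) \<le> enc (g a) \<and> enc (g a) \<le> enc (f a)) = (f a = g a)" for a
    by (metis enc_eq_iff order_antisym_conv order_refl)
  ultimately show ?thesis by simp
qed

lemma decidable_all:
  fixes P :: "'a::coded \<Rightarrow> nat \<Rightarrow> bool"
  assumes "computable N" "decidable (\<lambda>p. P (fst p) (snd p))"
  shows "decidable (\<lambda>a. \<forall>i<N a. P a i)"
proof -
  have "computable (\<lambda>a. rec_nat 1 (\<lambda>i r. r * of_bool (P a i)) (N a) :: nat)"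
    by (intro computable_rec computable_const computable_mult assms(1) computable_snd computable_id
        computable_comp2[OF assms(2)[unfolded decidable_def]] computable_fst)
  moreover have "rec_nat 1 (\<lambda>i r. r * of_bool (P a i)) k = (of_bool (\<forall>i<k. P a i) :: nat)" for a k
    by (induction k) (auto simp: less_Suc_eq)
  ultimately show ?thesis unfolding decidable_def by simp
qed

lemma computable_if:
  fixes f g :: "'a::coded \<Rightarrow> 'b::coded"
  assumes "decidable P" "computable f" "computable g"
  shows "computable (\<lambda>a. if P a then f a else g a)"
proof -
  have "computable (\<lambda>a. rec_nat (g a) (\<lambda>i r. f a) (of_bool (P a)))"
    using assms(1) unfolding decidable_def
    by (intro computable_rec computable_o_fst[OF assms(2)] assms(3))
  moreover have "rec_nat v (\<lambda>i r. u) (of_bool A) = (if A then u else v)" for u v :: 'b and A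
    by auto
  ultimately show ?thesis by simp
qed

lemma computable_Cons: "computable f \<Longrightarrow> computable g \<Longrightarrow> computable (\<lambda>a. f a # g a)"
  by (rule computable_comp2[where f = Cons], rule computableI[OF unary_pr_intros(2)[OF unary_pr_id]])
    (simp_all add: enc_prod_def)

text \<open>The default \<open>dec 0\<close> is what the computation on codes yields:
  \<open>enc [] - 1\<close> is 0, which decodes to the pair (0, 0).\<close>

definition hd0 :: "'a::coded list \<Rightarrow> 'a" where
  "hd0 xs = (case xs of [] \<Rightarrow> dec 0 | x # _ \<Rightarrow> x)"

lemma prod_decode_0 [simp]: "prod_decode 0 = (0, 0)"
  by (simp add: prod_decode_def prod_decode_aux.simps)

lemma computable_hd0: "computable f \<Longrightarrow> computable (\<lambda>a. hd0 (f a))"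
  by (rule computable_comp[where f = hd0],
      rule computableI[OF unary_pr_intros(8)[OF unary_pr_intros(3)[OF unary_pr_id]]])
    (auto simp: hd0_def split: list.split)

lemma computable_tl: "computable f \<Longrightarrow> computable (\<lambda>a. tl (f a))"
proof (rule computable_comp[where f = tl],
    rule computableI[OF unary_pr_intros(9)[OF unary_pr_intros(3)[OF unary_pr_id]]])
  show "enc (tl xs) = snd (prod_decode (enc xs - 1))" for xs :: "'b list"
    by (cases xs) auto
qed

lemma computable_drop:
  assumes "computable f" "computable g"
  shows "computable (\<lambda>a. drop (g a) (f a))"
proof -
  have "computable (\<lambda>a. rec_nat (f a) (\<lambda>i r. tl r) (g a))"
    by (intro computable_rec computable_tl computable_snd computable_id assms)
  moreover have "rec_nat xs (\<lambda>i r. tl r) k = drop k xs" for xs :: "'b list" and k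
    by (induction k) (auto simp: drop_Suc tl_drop)
  ultimately show ?thesis by simp
qed

text \<open>A bound for the recursion that computes the length by counting the \<open>i\<close>
  below \<open>enc xs\<close> for which \<open>drop i xs\<close> is not empty.\<close>

lemma length_le_enc: "length xs \<le> enc xs"
proof (induction xs)
  case (Cons x xs)
  then show ?case using le_prod_encode_2[of "enc xs" "enc x"] by simp
qed simp

lemma computable_length:
  assumes "computable f"
  shows "computable (\<lambda>a. length (f a))"
proof -
  have "computable (\<lambda>a. rec_nat 0 (\<lambda>i r. r + of_bool (drop i (f a) \<noteq> [])) (enc (f a)) :: nat)"
    by (intro computable_rec computable_enc computable_add computable_snd computable_id
        computable_const decidable_not[unfolded decidable_def] decidable_eq[unfolded decidable_def]
        computable_drop computable_o_fst[OF assms] assms computable_fst)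
  moreover have "rec_nat 0 (\<lambda>i r. r + of_bool (drop i xs \<noteq> [])) k = (min k (length xs) :: nat)"
    for xs :: "'b list" and k
    by (induction k) auto
  ultimately show ?thesis by (simp add: length_le_enc min_absorb2)
qed

text \<open>Out of range \<open>!\<close> has no known value, so its computability could not be
  shown; here the value is \<open>dec 0\<close>. For a string \<tau> of numbers,
  \<open>nth0 \<tau>\<close> is \<tau> continued by zeros, which lets functions of infinite
  sequences be applied to strings.\<close>

definition nth0 :: "'a::coded list \<Rightarrow> nat \<Rightarrow> 'a" where
  "nth0 xs i = hd0 (drop i xs)"

lemma nth0_nth [simp]: "i < length xs \<Longrightarrow> nth0 xs i = xs ! i"
  by (simp add: nth0_def hd0_def Cons_nth_drop_Suc[symmetric])

lemma computable_nth0: "computable f \<Longrightarrow> computable g \<Longrightarrow> computable (\<lambda>a. nth0 (f a) (g a))"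
  unfolding nth0_def by (intro computable_hd0 computable_drop)

lemma computable_append:
  fixes f g :: "'a::coded \<Rightarrow> 'b::coded list"
  assumes "computable f" "computable g"
  shows "computable (\<lambda>a. f a @ g a)"
proof -
  have "computable (\<lambda>a. rec_nat (g a) (\<lambda>i r. nth0 (f a) (length (f a) - Suc i) # r) (length (f a)))"
    by (intro computable_rec computable_Cons computable_length computable_nth0 computable_diff
        computable_Suc computable_snd computable_id computable_o_fst[OF assms(1)] assms
        computable_fst)
  moreover have "rec_nat ys (\<lambda>i r. nth0 xs (length xs - Suc i) # r) k = drop (length xs - k) xs @ ys"
    if "k \<le> length xs" for xs ys :: "'b list" and k
    using that by (induction k) (auto simp: Suc_diff_Suc Cons_nth_drop_Suc[symmetric])
  ultimately show ?thesis by simp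
qed

lemma computable_prod_encode:
  "computable f \<Longrightarrow> computable g \<Longrightarrow> computable (\<lambda>a. prod_encode (f a, g a))"
  using computable_enc[OF computable_Pair[of f g]] by (simp add: enc_prod_def enc_nat_def)

lemma decidable_ball:
  assumes "computable f" "decidable (\<lambda>p. P (fst p) (snd p))"
  shows "decidable (\<lambda>a. \<forall>x\<in>set (f a). P a x)"
proof -
  have "decidable (\<lambda>p. P (fst p) (nth0 (f (fst p)) (snd p)))"
    using decidable_comp[OF assms(2), of "\<lambda>p. (fst p, nth0 (f (fst p)) (snd p))"] assms(1)
    by (simp add: computable_Pair computable_nth0 computable_fst computable_snd computable_id computable_comp)
  then have "decidable (\<lambda>a. \<forall>i<length (f a). P a (nth0 (f a) i))"
    by (intro decidable_all computable_length assms(1))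
  then show ?thesis
    by (simp add: all_set_conv_all_nth)
qed

lemma decidable_distinct: "computable f \<Longrightarrow> decidable (\<lambda>a. distinct (f a))"
proof -
  assume f: "computable f"
  have "decidable (\<lambda>a. \<forall>i<length (f a). \<forall>j<i. nth0 (f a) i \<noteq> nth0 (f a) j)"
    by (intro decidable_all decidable_not decidable_eq computable_length computable_nth0
        computable_snd computable_id computable_o_fst[OF computable_o_fst[OF f]] f computable_fst)
  moreover have "(\<forall>i<length xs. \<forall>j<i. nth0 xs i \<noteq> nth0 xs j) \<longleftrightarrow> distinct xs" for xs :: "'b list"
    unfolding distinct_conv_nth
  proof (intro iffI allI impI)
    fix i j
    assume *: "\<forall>i<length xs. \<forall>j<i. nth0 xs i \<noteq> nth0 xs j" "i < length xs" "j < length xs" "i \<noteq> j"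
    then consider "i < j" | "j < i" by linarith
    then show "xs ! i \<noteq> xs ! j"
    proof cases
      case 1
      with *(1)[rule_format, of j i] * show ?thesis by (simp add: eq_commute)
    next
      case 2
      with *(1)[rule_format, of i j] * show ?thesis by simp
    qed
  qed simp
  ultimately show ?thesis by simp
qed

section \<open>Semidecidable predicates\<close>

definition semidec :: "('a::coded \<Rightarrow> bool) \<Rightarrow> bool" where
  "semidec P \<longleftrightarrow> (\<exists>Q. decidable (\<lambda>p. Q (fst p) (snd p)) \<and> (\<forall>a. P a \<longleftrightarrow> (\<exists>b::nat. Q a b)))"

lemma semidecI:
  fixes Q :: "'a::coded \<Rightarrow> 'b::coded \<Rightarrow> bool"
  assumes "decidable (\<lambda>p. Q (fst p) (snd p))" "\<And>a. P a \<longleftrightarrow> (\<exists>b. Q a b)"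
  shows "semidec P"
proof -
  have "decidable (\<lambda>p. Q (fst p) (dec (snd p)))"
    using decidable_comp[OF assms(1), of "\<lambda>p. (fst p, dec (snd p))"]
    by (simp add: computable_Pair computable_fst computable_snd computable_id computable_comp computable_dec)
  moreover have "P a \<longleftrightarrow> (\<exists>b. Q a (dec b))" for a
    using assms(2) by (metis dec_enc)
  ultimately show ?thesis
    unfolding semidec_def by (intro exI[of _ "\<lambda>a b. Q a (dec b)"]) simp
qed

lemma semidec_decidable: "decidable P \<Longrightarrow> semidec P"
  by (rule semidecI[where Q = "\<lambda>a (b::nat). P a"]) (auto intro: decidable_comp[OF _ computable_fst[OF computable_id]])

lemma semidec_comp:
  assumes "semidec P" "computable f"
  shows "semidec (\<lambda>a. P (f a))"
proof -
  obtain Q where Q: "decidable (\<lambda>p. Q (fst p) (snd p))" "\<And>a. P a \<longleftrightarrow> (\<exists>b::nat. Q a b)"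
    using assms(1) unfolding semidec_def by blast
  have "decidable (\<lambda>p. Q (f (fst p)) (snd p))"
    using decidable_comp[OF Q(1), of "\<lambda>p. (f (fst p), snd p)"] assms(2)
    by (simp add: computable_Pair computable_fst computable_snd computable_id computable_comp)
  then show ?thesis using Q(2) by (intro semidecI[where Q = "\<lambda>a b. Q (f a) b"])
qed

lemma semidec_comp2:
  "semidec (\<lambda>p. P (fst p) (snd p)) \<Longrightarrow> computable f \<Longrightarrow> computable g \<Longrightarrow> semidec (\<lambda>a. P (f a) (g a))"
  using semidec_comp[of "\<lambda>p. P (fst p) (snd p)" "\<lambda>a. (f a, g a)"] computable_Pair by auto

lemma semidec_ex:
  assumes "semidec (\<lambda>p. P (fst p) (snd p))"
  shows "semidec (\<lambda>a. \<exists>x. P a x)"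
proof -
  obtain Q where Q: "decidable (\<lambda>p. Q (fst p) (snd p))" "\<And>p. P (fst p) (snd p) \<longleftrightarrow> (\<exists>b::nat. Q p b)"
    using assms unfolding semidec_def by blast
  have "decidable (\<lambda>p. Q (fst p, fst (snd p)) (snd (snd p)))"
    using decidable_comp[OF Q(1), of "\<lambda>p. ((fst p, fst (snd p)), snd (snd p))"]
    by (simp add: computable_Pair computable_fst computable_snd computable_id)
  moreover have "(\<exists>x. P a x) \<longleftrightarrow> (\<exists>q. Q (a, fst q) (snd q))" for a
    using Q(2)[of "(a, _)"] by auto
  ultimately show ?thesis by (intro semidecI[where Q = "\<lambda>a q. Q (a, fst q) (snd q)"])
qed

lemma semidec_conj:
  assumes "semidec P" "semidec P'"
  shows "semidec (\<lambda>a. P a \<and> P' a)"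
proof -
  obtain Q where Q: "decidable (\<lambda>p. Q (fst p) (snd p))" "\<And>a. P a \<longleftrightarrow> (\<exists>b::nat. Q a b)"
    using assms unfolding semidec_def by blast
  obtain Q' where Q': "decidable (\<lambda>p. Q' (fst p) (snd p))" "\<And>a. P' a \<longleftrightarrow> (\<exists>b::nat. Q' a b)"
    using assms unfolding semidec_def by blast
  have "decidable (\<lambda>p. Q (fst p) (fst (snd p)) \<and> Q' (fst p) (snd (snd p)))"
    using decidable_comp[OF Q(1), of "\<lambda>p. (fst p, fst (snd p))"]
      decidable_comp[OF Q'(1), of "\<lambda>p. (fst p, snd (snd p))"]
    by (intro decidable_conj) (simp_all add: computable_Pair computable_fst computable_snd computable_id)
  then show ?thesis
    by (intro semidecI[where Q = "\<lambda>a q. Q a (fst q) \<and> Q' a (snd q)"]) (auto simp: Q(2) Q'(2))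
qed

text \<open>The witnesses for the finitely many \<open>i\<close> are gathered in one list, and lists
  are coded by numbers.\<close>

lemma semidec_all:
  fixes P :: "'a::coded \<Rightarrow> nat \<Rightarrow> bool"
  assumes "computable N" "semidec (\<lambda>p. P (fst p) (snd p))"
  shows "semidec (\<lambda>a. \<forall>i<N a. P a i)"
proof -
  obtain Q where Q: "decidable (\<lambda>p. Q (fst p) (snd p))" "\<And>p. P (fst p) (snd p) \<longleftrightarrow> (\<exists>b::nat. Q p b)"
    using assms unfolding semidec_def by blast
  have P: "P a i \<longleftrightarrow> (\<exists>b. Q (a, i) b)" for a i
    using Q(2)[of "(a, i)"] by simp
  have "decidable (\<lambda>p. Q (fst (fst p), snd p) (nth0 (snd (fst p)) (snd p)))"
    using decidable_comp[OF Q(1), of "\<lambda>p. ((fst (fst p), snd p), nth0 (snd (fst p)) (snd p))"]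
    by (simp add: computable_Pair computable_fst computable_snd computable_id computable_nth0)
  then have "decidable (\<lambda>p. \<forall>i<N (fst p). Q (fst p, i) (nth0 (snd p) i))"
    by (intro decidable_all computable_o_fst[OF assms(1)])
  moreover have "(\<forall>i<N a. P a i) \<longleftrightarrow> (\<exists>bs. \<forall>i<N a. Q (a, i) (nth0 bs i))" for a
  proof
    assume "\<forall>i<N a. P a i"
    then obtain b where "\<forall>i<N a. Q (a, i) (b i)" using P by metis
    then show "\<exists>bs. \<forall>i<N a. Q (a, i) (nth0 bs i)"
      by (intro exI[of _ "map b [0..<N a]"]) simp
  qed (use P in blast)
  ultimately show ?thesis by (intro semidecI[where Q = "\<lambda>a bs. \<forall>i<N a. Q (a, i) (nth0 bs i)"])
qed

lemma semidec_ball: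
  assumes "computable f" "semidec (\<lambda>p. P (fst p) (snd p))"
  shows "semidec (\<lambda>a. \<forall>x\<in>set (f a). P a x)"
proof -
  have "semidec (\<lambda>p. P (fst p) (nth0 (f (fst p)) (snd p)))"
    using semidec_comp[OF assms(2), of "\<lambda>p. (fst p, nth0 (f (fst p)) (snd p))"] assms(1)
    by (simp add: computable_Pair computable_nth0 computable_fst computable_snd computable_id computable_comp)
  then have "semidec (\<lambda>a. \<forall>i<length (f a). P a (nth0 (f a) i))"
    by (intro semidec_all computable_length assms(1))
  then show ?thesis
    by (simp add: all_set_conv_all_nth)
qed

lemma sigma01_iff_semidec: "sigma01 A \<longleftrightarrow> semidec (\<lambda>a. a \<in> A)"
proof
  assume "sigma01 A"
  then obtain f where f: "PR 2 f" "\<And>a. a \<in> A \<longleftrightarrow> (\<exists>b. f [a, b] = 0)"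
    unfolding sigma01_def by blast
  have "prn 2 (\<lambda>xs. f [xs ! 0, xs ! 1])"
    unfolding prn_def
  proof (intro exI conjI allI impI)
    show "f xs = f [xs ! 0, xs ! 1]" if "length xs = 2" for xs
      using that by (auto simp: numeral_2_eq_2 length_Suc_conv)
  qed (rule f(1))
  then have "unary_pr (\<lambda>k. f [fst (prod_decode k), snd (prod_decode k)])"
    unfolding unary_pr_def by (rule prn_comp2[where f = "\<lambda>a b. f [a, b]"]) (intro prn_fst_decode prn_snd_decode prn_proj; simp)+
  then have "computable (\<lambda>p. f [fst p, snd p])"
    by (rule computableI) (simp add: enc_prod_def enc_nat_def)
  then have "decidable (\<lambda>p. f [fst p, snd p] = 0)"
    by (intro decidable_eq computable_const)
  then show "semidec (\<lambda>a. a \<in> A)"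
    using f(2) by (intro semidecI[where Q = "\<lambda>a b. f [a, b] = 0"])
next
  assume "semidec (\<lambda>a. a \<in> A)"
  then obtain Q where Q: "decidable (\<lambda>p. Q (fst p) (snd p))" "\<And>a. a \<in> A \<longleftrightarrow> (\<exists>b::nat. Q a b)"
    unfolding semidec_def by blast
  \<comment> \<open>In \<open>sigma01\<close> the value 0 signals membership, so the characteristic
    function of the negation is taken.\<close>
  obtain g where g0: "unary_pr g" "\<And>p. enc (of_bool (\<not> Q (fst p) (snd p)) :: nat) = g (enc p)"
    using decidable_not[OF Q(1)] unfolding decidable_def computable_def by blast
  have g: "of_bool (\<not> Q a b) = g (prod_encode (a, b))" for a b
    using g0(2)[of "(a, b)"] by (simp only: enc_prod_def enc_nat_def fst_conv snd_conv)
  have "prn 2 (\<lambda>xs. g (prod_encode (xs ! 0, xs ! 1)))"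
    using g0(1) unfolding unary_pr_def
    by (rule prn_comp1) (intro prn_prod_encode prn_proj; simp)
  then obtain f where f: "PR 2 f" "\<And>xs. length xs = 2 \<Longrightarrow> f xs = g (prod_encode (xs ! 0, xs ! 1))"
    unfolding prn_def by blast
  have "f [a, b] = 0 \<longleftrightarrow> Q a b" for a b
    using f(2)[of "[a, b]"] g[of a b, symmetric] by simp
  then show "sigma01 A"
    unfolding sigma01_def using f(1) Q(2) by auto
qed

lemmas computable_intros =
  computable_id computable_const computable_fst computable_snd computable_Pair computable_Suc
  computable_add computable_mult computable_diff computable_power computable_if computable_Cons
  computable_length computable_nth0 computable_append computable_prod_encode computable_rec
  decidable_le decidable_less decidable_not decidable_conj decidable_eq
  decidable_all decidable_ball decidable_distinct

section \<open>Countability of the class of Sigma01 sets\<close>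

datatype pr_term = Zero_t | Succ_t | Proj_t nat | Comp_t pr_term "pr_term list" | Rec_t pr_term pr_term

instance pr_term :: countable
  by countable_datatype

text \<open>Terms are counted instead of functions. They carry no arities, so ill-formed terms
  denote something too, which is harmless for an upper bound on the number of sets.\<close>

fun pr_eval :: "pr_term \<Rightarrow> nat list \<Rightarrow> nat" where
  "pr_eval Zero_t = (\<lambda>_. 0)"
| "pr_eval Succ_t = (\<lambda>xs. Suc (hd xs))"
| "pr_eval (Proj_t i) = (\<lambda>xs. xs ! i)"
| "pr_eval (Comp_t f gs) = (\<lambda>xs. pr_eval f (map (\<lambda>g. pr_eval g xs) gs))"
| "pr_eval (Rec_t f g) =
    (\<lambda>xs. rec_nat (pr_eval f (tl xs)) (\<lambda>y r. pr_eval g (y # r # tl xs)) (hd xs))"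

lemma PR_pr_eval: "PR n f \<Longrightarrow> \<exists>t. f = pr_eval t"
proof (induction rule: PR.induct)
  case (PR_comp m f gs n)
  then obtain t where t: "f = pr_eval t" by blast
  obtain c where c: "\<And>g. g \<in> set gs \<Longrightarrow> g = pr_eval (c g)"
    using PR_comp by metis
  have "map (\<lambda>g. g xs) gs = map (\<lambda>g. pr_eval g xs) (map c gs)" for xs
    unfolding map_map comp_def by (intro map_cong refl fun_cong[OF c])
  then have "(\<lambda>xs. f (map (\<lambda>g. g xs) gs)) = pr_eval (Comp_t t (map c gs))"
    unfolding pr_eval.simps t by (intro ext) (rule arg_cong)
  then show ?case by blast
next
  case (PR_zero n)
  show ?case by (rule exI[of _ Zero_t]) simp
next
  case PR_succ
  show ?case by (rule exI[of _ Succ_t]) simp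
next
  case (PR_proj i n)
  show ?case by (rule exI[of _ "Proj_t i"]) simp
next
  case (PR_rec n f g)
  then obtain s t where "f = pr_eval s" "g = pr_eval t" by blast
  then show ?case by (intro exI[of _ "Rec_t s t"]) simp
qed

lemma countable_sigma01: "countable {A. sigma01 A}"
proof -
  have "{A. sigma01 A} \<subseteq> range (\<lambda>t. {a. \<exists>b. pr_eval t [a, b] = 0})"
    unfolding sigma01_def using PR_pr_eval by blast
  then show ?thesis by (rule countable_subset) simp
qed

section \<open>Uniform measures and tests\<close>

lemma prob_space_unif: "prob_space (unif m)"
  unfolding unif_def by (intro prob_space_PiM measure_pmf.prob_space_axioms)

interpretation unif: prob_space "unif m" for m
  by (rule prob_space_unif)

lemma space_unif [simp]: "space (unif m) = UNIV"
  by (simp add: unif_def space_PiM)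

lemma measurable_unif_coord [measurable]: "(\<lambda>x. x i) \<in> measurable (unif m) (count_space UNIV)"
proof -
  have "(\<lambda>x. x i) \<in> measurable (unif m) (measure_pmf (pmf_of_set {..<m}))"
    unfolding unif_def by (rule measurable_component_singleton) simp
  then show ?thesis by simp
qed

lemma measure_unif_coords:
  assumes "finite J" "\<And>j. j \<in> J \<Longrightarrow> v j < m"
  shows "measure (unif m) {x. \<forall>j\<in>J. x j = v j} = (1 / real m) ^ card J"
proof -
  interpret product_prob_space "\<lambda>_::nat. measure_pmf (pmf_of_set {..<m})" UNIV
    by (rule product_prob_spaceI) (rule measure_pmf.prob_space_axioms)
  have "emeasure (unif m) {x. \<forall>j\<in>J. x j = v j} =
      (\<Prod>j\<in>J. emeasure (measure_pmf (pmf_of_set {..<m})) {v j})"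
    using emeasure_PiM_Collect[of J "\<lambda>j. {v j}"] assms(1) by (simp add: unif_def space_PiM)
  also have "\<dots> = (\<Prod>j\<in>J. ennreal (1 / real m))"
  proof (intro prod.cong refl)
    fix j assume "j \<in> J"
    then have "v j < m" by (rule assms(2))
    moreover from this have "{..<m} \<noteq> {}" by auto
    ultimately show "emeasure (measure_pmf (pmf_of_set {..<m})) {v j} = ennreal (1 / real m)"
      by (simp add: emeasure_pmf_single)
  qed
  also have "\<dots> = ennreal ((1 / real m) ^ card J)"
    by (simp add: ennreal_power)
  finally show ?thesis by (simp add: measure_def)
qed

lemma cyl_iff: "x \<in> cyl \<sigma> \<longleftrightarrow> map x [0..<length \<sigma>] = \<sigma>"
  unfolding cyl_def by (subst list_eq_iff_nth_eq) simp

lemma sets_cyl [measurable]: "cyl \<sigma> \<in> sets (unif m)"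
proof -
  have "{x \<in> space (unif m). \<forall>i<length \<sigma>. x i = \<sigma> ! i} \<in> sets (unif m)"
    by measurable
  then show ?thesis by (simp add: cyl_def)
qed

lemma measure_cyl:
  assumes "set \<sigma> \<subseteq> {..<m}"
  shows "measure (unif m) (cyl \<sigma>) = (1 / real m) ^ length \<sigma>"
proof -
  have "cyl \<sigma> = {x. \<forall>j\<in>{..<length \<sigma>}. x j = \<sigma> ! j}"
    by (auto simp: cyl_def)
  then show ?thesis
    using measure_unif_coords[of "{..<length \<sigma>}" "\<lambda>j. \<sigma> ! j" m] assms nth_mem by fastforce
qed

lemma sets_seqs [measurable]: "seqs m \<in> sets (unif k)"
proof -
  have "{x \<in> space (unif k). \<forall>i. x i < m} \<in> sets (unif k)"
    by measurable
  then show ?thesis by (simp add: seqs_def)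
qed

text \<open>\<open>unif m\<close> is a measure on all sequences of naturals, in which
  \<open>seqs m\<close> is only a subset of full measure. Arguments about words over
  \<open>{..<m}\<close> therefore intersect with \<open>seqs m\<close>.\<close>

lemma AE_unif_seqs:
  assumes "0 < m"
  shows "AE x in unif m. x \<in> seqs m"
proof -
  have "AE x in unif m. x i < m" for i
  proof -
    have "measure (unif m) (\<Union>a\<in>{..<m}. {x. x i = a}) = (\<Sum>a<m. measure (unif m) {x. x i = a})"
    proof (rule unif.finite_measure_finite_Union)
      have "{x \<in> space (unif m). x i = a} \<in> sets (unif m)" for a by measurable
      then show "(\<lambda>a. {x. x i = a}) ` {..<m} \<subseteq> sets (unif m)" by auto
    qed (auto simp: disjoint_family_on_def)
    also have "\<dots> = (\<Sum>a<m. 1 / real m)"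
      using measure_unif_coords[of "{i}" _ m] by (intro sum.cong) (auto simp: )
    also have "\<dots> = 1" using assms by simp
    also have "(\<Union>a\<in>{..<m}. {x. x i = a}) = {x \<in> space (unif m). x i < m}" by auto
    finally have "AE x in unif m. x \<in> {x \<in> space (unif m). x i < m}"
      by (rule unif.AE_prob_1)
    then show ?thesis by simp
  qed
  then show ?thesis by (simp add: seqs_def AE_all_countable)
qed

lemma measure_Int_seqs:
  assumes "0 < m" and [measurable]: "A \<in> sets (unif m)"
  shows "measure (unif m) (A \<inter> seqs m) = measure (unif m) A"
  using AE_unif_seqs[OF assms(1)] by (intro unif.finite_measure_eq_AE) auto

section \<open>Open sets generated by sets of strings\<close>

definition cyls :: "nat list set \<Rightarrow> (nat \<Rightarrow> nat) set" where
  "cyls S = {x. \<exists>k. map x [0..<k] \<in> S}"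

lemma cyls_eq_UN: "cyls S = (\<Union>\<sigma>\<in>S. cyl \<sigma>)"
proof (rule set_eqI)
  fix x
  show "x \<in> cyls S \<longleftrightarrow> x \<in> (\<Union>\<sigma>\<in>S. cyl \<sigma>)"
  proof
    assume "x \<in> cyls S"
    then obtain k where "map x [0..<k] \<in> S" by (auto simp: cyls_def)
    then show "x \<in> (\<Union>\<sigma>\<in>S. cyl \<sigma>)"
      by (auto simp: cyl_iff intro!: bexI[of _ "map x [0..<k]"])
  next
    assume "x \<in> (\<Union>\<sigma>\<in>S. cyl \<sigma>)"
    then obtain \<sigma> where "\<sigma> \<in> S" "map x [0..<length \<sigma>] = \<sigma>" by (auto simp: cyl_iff)
    then show "x \<in> cyls S"
      by (auto simp: cyls_def intro!: exI[of _ "length \<sigma>"])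
  qed
qed

lemma sets_cyls [measurable]: "cyls S \<in> sets (unif m)"
  unfolding cyls_eq_UN by (rule sets.countable_UN') auto

lemma test_set_eq_cyls: "test_set W i = cyls {\<sigma>. prod_encode (i, list_encode \<sigma>) \<in> W}"
  unfolding test_set_def cyls_eq_UN by auto

text \<open>The prefix-free part of \<open>S\<close>: it generates the same open set, but its
  cylinders are disjoint, so their measures can be added.\<close>

definition minimal :: "nat list set \<Rightarrow> nat list set" where
  "minimal S = {\<tau> \<in> S. \<forall>k<length \<tau>. take k \<tau> \<notin> S}"

lemma ex_minimal_prefix:
  assumes "\<tau> \<in> S"
  shows "\<exists>k. take k \<tau> \<in> minimal S"
proof -
  define k where "k = (LEAST k. take k \<tau> \<in> S)"
  have "\<exists>k. take k \<tau> \<in> S" using assms by (intro exI[of _ "length \<tau>"]) simp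
  then have "take k \<tau> \<in> S" unfolding k_def by (rule LeastI_ex)
  moreover have "take j (take k \<tau>) \<notin> S" if "j < length (take k \<tau>)" for j
  proof -
    have "j < k" using that by simp
    then show ?thesis
      using not_less_Least[of j "\<lambda>k. take k \<tau> \<in> S"] by (simp add: k_def[symmetric] min_absorb1)
  qed
  ultimately show ?thesis unfolding minimal_def by blast
qed

lemma take_prefix: "take j (map x [0..<k]) = map x [0..<min j k]"
  by (cases "j \<le> k") (simp_all add: take_map take_upt)

lemma cyls_minimal: "cyls (minimal S) = cyls S"
proof -
  have "\<exists>j. map x [0..<j] \<in> minimal S" if k: "map x [0..<k] \<in> S" for x k
  proof -
    obtain j where "take j (map x [0..<k]) \<in> minimal S"
      using ex_minimal_prefix[OF k] by blast
    then show ?thesis unfolding take_prefix by blast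
  qed
  then show ?thesis by (auto simp: cyls_def minimal_def)
qed

lemma disjoint_cyl_minimal: "disjoint_family_on cyl (minimal S)"
proof -
  have "\<sigma> = \<tau>" if "\<sigma> \<in> minimal S" "\<tau> \<in> minimal S" "x \<in> cyl \<sigma>" "x \<in> cyl \<tau>" "length \<sigma> \<le> length \<tau>" for x \<sigma> \<tau>
  proof -
    have "\<sigma> = take (length \<sigma>) \<tau>"
      using that(3-5) unfolding cyl_iff by (metis min_def take_map take_upt add_0 diff_zero)
    then have "\<not> length \<sigma> < length \<tau>"
      using that(1,2) unfolding minimal_def by fastforce
    with that(5) \<open>\<sigma> = take (length \<sigma>) \<tau>\<close> show ?thesis by simp
  qed
  then show ?thesis unfolding disjoint_family_on_def
    by (metis disjoint_iff nle_le)
qed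

text \<open>A Martin-Loef test on strings rather than on codes. The class \<open>coded\<close> codes
  a number paired with a string exactly as \<open>test_set\<close> does, so the two notions
  translate into each other through \<open>enc\<close> and \<open>dec\<close>.\<close>

definition test :: "nat \<Rightarrow> (nat \<Rightarrow> nat list \<Rightarrow> bool) \<Rightarrow> bool" where
  "test m P \<longleftrightarrow> semidec (\<lambda>p. P (fst p) (snd p)) \<and>
     (\<forall>i. measure (unif m) (cyls (Collect (P i))) \<le> 1 / 2 ^ i)"

lemma semidec_test: "sigma01 W \<Longrightarrow> semidec (\<lambda>p. prod_encode (fst p, list_encode (snd p)) \<in> W)"
proof -
  assume "sigma01 W"
  then have "semidec (\<lambda>p :: nat \<times> nat list. enc p \<in> W)"
    unfolding sigma01_iff_semidec
    by (rule semidec_comp[where f = enc]) (intro computable_enc computable_id)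
  then show ?thesis by (simp add: enc_prod_def enc_nat_list enc_nat_def)
qed

lemma martin_loef_test_iff:
  "martin_loef_test m W \<longleftrightarrow> test m (\<lambda>i \<sigma>. prod_encode (i, list_encode \<sigma>) \<in> W)"
proof -
  have "semidec (\<lambda>p. prod_encode (fst p, list_encode (snd p)) \<in> W) \<longleftrightarrow> sigma01 W"
  proof
    assume *: "semidec (\<lambda>p. prod_encode (fst p, list_encode (snd p)) \<in> W)"
    have "semidec (\<lambda>k. enc (dec k :: nat \<times> nat list) \<in> W)"
      using semidec_comp[OF *, of "dec :: nat \<Rightarrow> nat \<times> nat list"] computable_dec
      by (simp add: enc_prod_def enc_nat_list enc_nat_def)
    then show "sigma01 W" unfolding sigma01_iff_semidec by simp
  qed (rule semidec_test)
  then show ?thesis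
    unfolding martin_loef_test_def test_def test_set_eq_cyls
    by (simp add: unif.emeasure_eq_measure)
qed

lemma test_obtain_code:
  assumes "semidec (\<lambda>p. P (fst p) (snd p))"
  obtains W where "P = (\<lambda>i \<sigma>. prod_encode (i, list_encode \<sigma>) \<in> W)" "sigma01 W"
proof
  let ?W = "{k. P (fst (dec k :: nat \<times> nat list)) (snd (dec k :: nat \<times> nat list))}"
  have "dec (prod_encode (i, list_encode \<sigma>)) = (i, \<sigma>)" for i and \<sigma> :: "nat list"
  proof -
    have "prod_encode (i, list_encode \<sigma>) = enc (i, \<sigma>)"
      by (simp add: enc_prod_def enc_nat_list enc_nat_def)
    then show ?thesis by (simp del: enc_dec)
  qed
  then show "P = (\<lambda>i \<sigma>. prod_encode (i, list_encode \<sigma>) \<in> ?W)" by simp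
  show "sigma01 ?W"
    unfolding sigma01_iff_semidec using semidec_comp[OF assms computable_dec] by simp
qed

lemma martin_loef_random_iff:
  "martin_loef_random m x \<longleftrightarrow>
     x \<in> seqs m \<and> (\<forall>P. test m P \<longrightarrow> (\<exists>i. x \<notin> cyls (Collect (P i))))"
proof -
  have "(\<forall>W. martin_loef_test m W \<longrightarrow> x \<notin> (\<Inter>i. test_set W i)) \<longleftrightarrow>
      (\<forall>P. test m P \<longrightarrow> (\<exists>i. x \<notin> cyls (Collect (P i))))"
  proof (intro iffI allI impI)
    fix P
    assume *: "\<forall>W. martin_loef_test m W \<longrightarrow> x \<notin> (\<Inter>i. test_set W i)" "test m P"
    then obtain W where "P = (\<lambda>i \<sigma>. prod_encode (i, list_encode \<sigma>) \<in> W)"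
      unfolding test_def using test_obtain_code by metis
    with * show "\<exists>i. x \<notin> cyls (Collect (P i))"
      by (auto simp: martin_loef_test_iff test_set_eq_cyls)
  qed (auto simp: martin_loef_test_iff test_set_eq_cyls)
  then show ?thesis by (simp add: martin_loef_random_def)
qed

text \<open>This permits one level to be chosen for every test at once, along an enumeration that
  need not be effective.\<close>

lemma countable_tests: "countable (Collect (test m))"
proof -
  have "Collect (test m) \<subseteq> (\<lambda>W i \<sigma>. prod_encode (i, list_encode \<sigma>) \<in> W) ` {W. sigma01 W}"
  proof
    fix P assume "P \<in> Collect (test m)"
    then have "semidec (\<lambda>p. P (fst p) (snd p))" by (simp add: test_def)
    then obtain W where "P = (\<lambda>i \<sigma>. prod_encode (i, list_encode \<sigma>) \<in> W)" "sigma01 W"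
      by (rule test_obtain_code)
    then show "P \<in> (\<lambda>W i \<sigma>. prod_encode (i, list_encode \<sigma>) \<in> W) ` {W. sigma01 W}" by blast
  qed
  then show ?thesis by (rule countable_subset) (intro countable_image countable_sigma01)
qed

section \<open>Independence of the columns\<close>

definition bit_column :: "nat \<Rightarrow> (nat \<Rightarrow> nat) \<Rightarrow> nat \<Rightarrow> nat" where
  "bit_column n x = (\<lambda>k. x (prod_encode (n, k)))"

lemma restrict_UNIV: "restrict f UNIV = f"
  by (simp add: restrict_def)

lemma distr_column: "distr (unif m) (unif m) (bit_column n) = unif m"
proof -
  have "distr (PiM UNIV (\<lambda>_. measure_pmf (pmf_of_set {..<m}))) (PiM UNIV (\<lambda>_. measure_pmf (pmf_of_set {..<m})))
      (\<lambda>\<omega>. \<lambda>k\<in>UNIV. \<omega> (prod_encode (n, k))) = PiM UNIV (\<lambda>_. measure_pmf (pmf_of_set {..<m}))"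
    by (rule distr_PiM_reindex) (auto simp: inj_on_def intro: measure_pmf.prob_space_axioms)
  then show ?thesis unfolding unif_def bit_column_def[abs_def] restrict_UNIV .
qed

text \<open>The coordinates are independent by the product construction. Columns read disjoint
  blocks \<open>?K n\<close> of coordinates, and functions of disjoint blocks are again
  independent.\<close>

lemma indep_columns: "unif.indep_vars m (\<lambda>_. unif m) bit_column UNIV"
proof -
  let ?M = "measure_pmf (pmf_of_set {..<m})"
  let ?K = "\<lambda>n. range (\<lambda>k. prod_encode (n, k))"
  have comp: "distr (unif m) ?M (\<lambda>x. x i) = ?M" for i
    unfolding unif_def
    by (rule distr_PiM_component[where M = "\<lambda>_. ?M"]) (auto intro: measure_pmf.prob_space_axioms)
  have "unif.indep_vars m (\<lambda>_. ?M) (\<lambda>i x. x i) UNIV"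
  proof (subst unif.indep_vars_iff_distr_eq_PiM)
    show "(\<lambda>x. x i) \<in> measurable (unif m) ?M" for i
      using measurable_unif_coord[of i m] by (simp only: measurable_pmf_measure2)
    have "distr (unif m) (PiM UNIV (\<lambda>_. ?M)) (\<lambda>x. \<lambda>i\<in>UNIV. x i) = unif m"
      unfolding restrict_UNIV unif_def by (rule distr_id)
    then show "distr (unif m) (PiM UNIV (\<lambda>_. ?M)) (\<lambda>x. \<lambda>i\<in>UNIV. x i) =
        PiM UNIV (\<lambda>i. distr (unif m) ?M (\<lambda>x. x i))"
      unfolding comp by (simp only: unif_def)
  qed simp
  then have "unif.indep_vars m (\<lambda>n. PiM (?K n) (\<lambda>_. ?M)) (\<lambda>n x. restrict (\<lambda>i. x i) (?K n)) UNIV"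
    by (rule unif.indep_vars_restrict) (auto simp: disjoint_family_on_def)
  then have "unif.indep_vars m (\<lambda>_. unif m)
      (\<lambda>n x. (\<lambda>\<omega> k. \<omega> (prod_encode (n, k))) (restrict (\<lambda>i. x i) (?K n))) UNIV"
  proof (rule unif.indep_vars_compose2)
    fix n
    have "(\<lambda>\<omega>. \<lambda>k\<in>UNIV. \<omega> (prod_encode (n, k))) \<in> measurable (PiM (?K n) (\<lambda>_. ?M)) (PiM UNIV (\<lambda>_. ?M))"
      by (intro measurable_restrict measurable_component_singleton) auto
    then show "(\<lambda>\<omega> k. \<omega> (prod_encode (n, k))) \<in> measurable (PiM (?K n) (\<lambda>_. ?M)) (unif m)"
      unfolding restrict_UNIV unif_def .
  qed
  then show ?thesis by (simp add: bit_column_def[abs_def])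
qed

lemma measure_columns:
  assumes "finite J" "J \<noteq> {}" "\<And>n. n \<in> J \<Longrightarrow> A n \<in> sets (unif m)"
  shows "measure (unif m) {x. \<forall>n\<in>J. bit_column n x \<in> A n} = (\<Prod>n\<in>J. measure (unif m) (A n))"
proof -
  have col: "bit_column n \<in> measurable (unif m) (unif m)" for n
    using indep_columns unfolding unif.indep_vars_def by auto
  have "measure (unif m) (\<Inter>n\<in>J. bit_column n -` A n \<inter> space (unif m)) =
      (\<Prod>n\<in>J. measure (unif m) (bit_column n -` A n \<inter> space (unif m)))"
    using assms by (intro unif.indep_varsD[OF indep_columns]) auto
  also have "\<dots> = (\<Prod>n\<in>J. measure (unif m) (A n))"
    using assms(3) measure_distr[OF col] distr_column by (intro prod.cong) metis+
  also have "(\<Inter>n\<in>J. bit_column n -` A n \<inter> space (unif m)) = {x. \<forall>n\<in>J. bit_column n x \<in> A n}"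
    using assms(2) by auto
  finally show ?thesis .
qed

section \<open>Randomness along measure-preserving maps of strings\<close>

lemma cylsI: "map x [0..<k] \<in> S \<Longrightarrow> x \<in> cyls S"
  unfolding cyls_def by blast

lemma compact_seqs: "compact (seqs m)"
proof -
  have "compactin (product_topology (\<lambda>_. euclidean) UNIV) (PiE UNIV (\<lambda>_::nat. {..<m}))"
    unfolding compactin_PiE by (simp add: finite_imp_compact)
  moreover have "PiE UNIV (\<lambda>_::nat. {..<m}) = seqs m"
    by (auto simp: seqs_def PiE_def Pi_def)
  ultimately show ?thesis
    by (simp add: euclidean_product_topology)
qed

text \<open>In a product of discrete spaces convergence means eventual agreement on every prefix;
  compactness is used in this form.\<close>

lemma seqs_convergent_subseq:
  fixes y :: "nat \<Rightarrow> nat \<Rightarrow> nat"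
  assumes "\<And>k. y k \<in> seqs m"
  shows "\<exists>x\<in>seqs m. \<exists>r :: nat \<Rightarrow> nat. strict_mono r \<and>
    (\<forall>k. \<forall>\<^sub>F j in sequentially. map (y (r j)) [0..<k] = map x [0..<k])"
proof -
  have "seq_compact (seqs m)" by (rule compact_imp_seq_compact[OF compact_seqs])
  moreover have "\<forall>k. y k \<in> seqs m" using assms by blast
  ultimately obtain x and r :: "nat \<Rightarrow> nat"
    where x: "x \<in> seqs m" "strict_mono r" "(y \<circ> r) \<longlonglongrightarrow> x"
    by (rule seq_compactE)
  have "(\<lambda>j. (y \<circ> r) j i) \<longlonglongrightarrow> x i" for i
    using continuous_on_tendsto_compose[OF continuous_on_product_coordinates x(3)] by simp
  then have "\<forall>\<^sub>F j in sequentially. y (r j) i = x i" for i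
    by (simp add: tendsto_discrete)
  then have "\<forall>\<^sub>F j in sequentially. \<forall>i\<in>{..<k}. y (r j) i = x i" for k
    by (intro eventually_ball_finite) auto
  then have "\<forall>\<^sub>F j in sequentially. map (y (r j)) [0..<k] = map x [0..<k]" for k
    by (rule eventually_mono[of "\<lambda>j. \<forall>i\<in>{..<k}. y (r j) i = x i"]) simp
  with x(1,2) show ?thesis by blast
qed

text \<open>A partial computable map from \<open>seqs m\<close> to \<open>seqs n\<close>, given by
  finite approximations: \<open>R \<sigma> \<tau>\<close> says that the prefix \<sigma> of the input
  already forces the output to begin with \<tau>. The set \<open>E \<tau>\<close> introduced below
  is the preimage of \<open>cyl \<tau>\<close>, so \<open>measure_R\<close> states that the map
  carries the uniform measure to the uniform measure.\<close>

locale string_map =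
  fixes m n :: nat and R :: "nat list \<Rightarrow> nat list \<Rightarrow> bool"
  assumes m_pos: "0 < m" and n_pos: "0 < n"
    and semidec_R: "semidec (\<lambda>p. R (fst p) (snd p))"
    and R_append: "R \<sigma> \<tau> \<Longrightarrow> R (\<sigma> @ \<rho>) \<tau>"
    and R_take: "R \<sigma> \<tau> \<Longrightarrow> R \<sigma> (take k \<tau>)"
    and R_unique: "R \<sigma> \<tau> \<Longrightarrow> R \<sigma> \<tau>' \<Longrightarrow> length \<tau> = length \<tau>' \<Longrightarrow> \<tau> = \<tau>'"
    and measure_R: "set \<tau> \<subseteq> {..<n} \<Longrightarrow>
      measure (unif m) (cyls {\<sigma>. R \<sigma> \<tau>}) = (1 / real n) ^ length \<tau>"
begin

abbreviation E :: "nat list \<Rightarrow> (nat \<Rightarrow> nat) set" where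
  "E \<tau> \<equiv> cyls {\<sigma>. R \<sigma> \<tau>}"

lemma R_prefix_mono:
  assumes "R (map x [0..<k]) \<tau>" "k \<le> l"
  shows "R (map x [0..<l]) \<tau>"
proof -
  have "map x [0..<l] = map x [0..<k] @ map x [k..<l]"
    using assms(2) by (metis le0 map_append upt_add_eq_append le_add_diff_inverse add_0)
  then show ?thesis using R_append[OF assms(1)] by simp
qed

lemma E_unique:
  assumes "x \<in> E \<tau>" "x \<in> E \<tau>'" "length \<tau> \<le> length \<tau>'"
  shows "\<tau> = take (length \<tau>) \<tau>'"
proof -
  obtain k l where "R (map x [0..<k]) \<tau>" "R (map x [0..<l]) \<tau>'"
    using assms by (auto simp: cyls_def)
  then have "R (map x [0..<max k l]) \<tau>" "R (map x [0..<max k l]) \<tau>'"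
    by (auto elim: R_prefix_mono)
  then show ?thesis
    using assms(3) by (intro R_unique[OF _ R_take]) auto
qed

lemma E_take: "E \<tau> \<subseteq> E (take k \<tau>)"
  using R_take by (auto simp: cyls_def)

lemma disjoint_E_minimal: "disjoint_family_on E (minimal S)"
proof -
  have "\<sigma> = \<tau>"
    if "\<sigma> \<in> minimal S" "\<tau> \<in> minimal S" "x \<in> E \<sigma>" "x \<in> E \<tau>" "length \<sigma> \<le> length \<tau>" for x \<sigma> \<tau>
  proof -
    have *: "\<sigma> = take (length \<sigma>) \<tau>"
      using that(3-5) by (rule E_unique)
    then have "\<not> length \<sigma> < length \<tau>"
      using that(1,2) unfolding minimal_def by fastforce
    with that(5) * show ?thesis by simp
  qed
  then show ?thesis unfolding disjoint_family_on_def
    by (metis disjoint_iff nle_le)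
qed

text \<open>The integral over \<open>count_space\<close> serves as the sum over a possibly infinite
  set of strings; with values in \<open>ennreal\<close> no question of convergence arises.\<close>

lemma emeasure_cyls_minimal:
  "emeasure (unif k) (cyls S) = (\<integral>\<^sup>+\<tau>. emeasure (unif k) (cyl \<tau>) \<partial>count_space (minimal S))"
proof -
  have "emeasure (unif k) (\<Union>\<tau>\<in>minimal S. cyl \<tau>) =
      (\<integral>\<^sup>+\<tau>. emeasure (unif k) (cyl \<tau>) \<partial>count_space (minimal S))"
    by (rule emeasure_UN_countable) (auto intro: disjoint_cyl_minimal)
  then show ?thesis by (metis cyls_eq_UN cyls_minimal)
qed

text \<open>For the martingale \<open>\<tau> \<mapsto> n ^ length \<tau> * measure (U \<inter> E \<tau>)\<close> this is Ville's inequality.\<close>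

lemma measure_cyls_le:
  assumes S: "\<And>\<tau>. \<tau> \<in> S \<Longrightarrow> set \<tau> \<subseteq> {..<n}" and U [measurable]: "U \<in> sets (unif m)" and "0 \<le> c"
    and le: "\<And>\<tau>. \<tau> \<in> S \<Longrightarrow> c * (1 / real n) ^ length \<tau> \<le> measure (unif m) (U \<inter> E \<tau>)"
  shows "c * measure (unif n) (cyls S) \<le> measure (unif m) U"
proof -
  have "ennreal (c * measure (unif n) (cyls S)) = ennreal c * emeasure (unif n) (cyls S)"
    using \<open>0 \<le> c\<close> by (simp add: ennreal_mult unif.emeasure_eq_measure)
  also have "\<dots> = (\<integral>\<^sup>+\<tau>. ennreal c * emeasure (unif n) (cyl \<tau>) \<partial>count_space (minimal S))"
    unfolding emeasure_cyls_minimal by (rule nn_integral_cmult[symmetric]) simp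
  also have "\<dots> \<le> (\<integral>\<^sup>+\<tau>. emeasure (unif m) (U \<inter> E \<tau>) \<partial>count_space (minimal S))"
  proof (rule nn_integral_mono)
    fix \<tau> assume "\<tau> \<in> space (count_space (minimal S))"
    then have "\<tau> \<in> S" by (simp add: minimal_def)
    then show "ennreal c * emeasure (unif n) (cyl \<tau>) \<le> emeasure (unif m) (U \<inter> E \<tau>)"
      using le[of \<tau>] S[of \<tau>] \<open>0 \<le> c\<close>
      by (simp add: unif.emeasure_eq_measure measure_cyl ennreal_mult[symmetric] ennreal_leI)
  qed
  \<comment> \<open>Minimal strings are incomparable, so no input has an image extending two of them
    and the pieces are disjoint.\<close>
  also have "\<dots> = emeasure (unif m) (\<Union>\<tau>\<in>minimal S. U \<inter> E \<tau>)"
    using disjoint_E_minimal[of S]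
    by (intro emeasure_UN_countable[symmetric]) (auto simp: disjoint_family_on_def)
  also have "\<dots> \<le> emeasure (unif m) U"
    by (rule emeasure_mono) auto
  finally show ?thesis by (simp add: unif.emeasure_eq_measure)
qed

text \<open>Every string of \<open>S\<close> has a minimal prefix, whose \<open>E\<close> contains
  its own. On the minimal strings the sets \<open>E \<tau>\<close> are disjoint, and by
  \<open>measure_R\<close> each has the measure of \<open>cyl \<tau>\<close>.\<close>

lemma measure_UN_E_le:
  assumes S: "\<And>\<tau>. \<tau> \<in> S \<Longrightarrow> set \<tau> \<subseteq> {..<n}"
  shows "measure (unif m) (\<Union>\<tau>\<in>S. E \<tau>) \<le> measure (unif n) (cyls S)"
proof -
  have "(\<Union>\<tau>\<in>S. E \<tau>) \<subseteq> (\<Union>\<tau>\<in>minimal S. E \<tau>)"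
  proof
    fix x assume "x \<in> (\<Union>\<tau>\<in>S. E \<tau>)"
    then obtain \<tau> where \<tau>: "\<tau> \<in> S" "x \<in> E \<tau>" by blast
    obtain k where "take k \<tau> \<in> minimal S" using ex_minimal_prefix[OF \<tau>(1)] by blast
    then show "x \<in> (\<Union>\<tau>\<in>minimal S. E \<tau>)" using \<tau>(2) E_take by blast
  qed
  then have "emeasure (unif m) (\<Union>\<tau>\<in>S. E \<tau>) \<le> emeasure (unif m) (\<Union>\<tau>\<in>minimal S. E \<tau>)"
    by (rule emeasure_mono) (rule sets.countable_UN', auto)
  also have "\<dots> = (\<integral>\<^sup>+\<tau>. emeasure (unif m) (E \<tau>) \<partial>count_space (minimal S))"
    by (rule emeasure_UN_countable) (auto intro: disjoint_E_minimal)
  also have "\<dots> = (\<integral>\<^sup>+\<tau>. emeasure (unif n) (cyl \<tau>) \<partial>count_space (minimal S))"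
  proof (rule nn_integral_cong)
    fix \<tau> assume "\<tau> \<in> space (count_space (minimal S))"
    then have "set \<tau> \<subseteq> {..<n}" using S by (simp add: minimal_def)
    then show "emeasure (unif m) (E \<tau>) = emeasure (unif n) (cyl \<tau>)"
      by (simp add: unif.emeasure_eq_measure measure_cyl measure_R)
  qed
  also have "\<dots> = emeasure (unif n) (cyls S)"
    by (rule emeasure_cyls_minimal[symmetric])
  finally show ?thesis by (simp add: unif.emeasure_eq_measure)
qed

theorem random_image:
  assumes x: "martin_loef_random m x" and z: "z \<in> seqs n" and xz: "\<And>k. x \<in> E (map z [0..<k])"
  shows "martin_loef_random n z"
  unfolding martin_loef_random_iff
proof (intro conjI allI impI z)
  fix P assume P: "test n P"
  \<comment> \<open>The pulled-back test. Digits are restricted to those below \<open>n\<close>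
    because \<open>measure_R\<close> gives the measure of \<open>E \<tau>\<close> for such strings
    only.\<close>
  define Q where "Q i \<sigma> \<longleftrightarrow> (\<exists>\<tau>. (\<forall>d\<in>set \<tau>. d < n) \<and> P i \<tau> \<and> R \<sigma> \<tau>)" for i \<sigma>
  have sP: "semidec (\<lambda>p. P (fst p) (snd p))" using P by (simp add: test_def)
  have "test m Q"
    unfolding test_def
  proof (intro conjI allI)
    show "semidec (\<lambda>p. Q (fst p) (snd p))"
      unfolding Q_def
      by (intro semidec_ex semidec_conj semidec_comp2[OF sP] semidec_comp2[OF semidec_R]
          semidec_decidable computable_intros)
    fix i
    have "cyls (Collect (Q i)) = (\<Union>\<tau>\<in>{\<tau>. (\<forall>d\<in>set \<tau>. d < n) \<and> P i \<tau>}. E \<tau>)"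
      by (auto simp: cyls_def Q_def)
    also have "measure (unif m) \<dots> \<le> measure (unif n) (cyls {\<tau>. (\<forall>d\<in>set \<tau>. d < n) \<and> P i \<tau>})"
      by (rule measure_UN_E_le) auto
    also have "\<dots> \<le> measure (unif n) (cyls (Collect (P i)))"
      by (rule unif.finite_measure_mono[OF _ sets_cyls]) (auto simp: cyls_def)
    also have "\<dots> \<le> 1 / 2 ^ i" using P by (simp add: test_def)
    finally show "measure (unif m) (cyls (Collect (Q i))) \<le> 1 / 2 ^ i" .
  qed
  then obtain i where i: "x \<notin> cyls (Collect (Q i))"
    using x unfolding martin_loef_random_iff by blast
  have "z \<notin> cyls (Collect (P i))"
  proof
    assume "z \<in> cyls (Collect (P i))"
    then obtain k where k: "P i (map z [0..<k])" by (auto simp: cyls_def)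
    obtain j where "R (map x [0..<j]) (map z [0..<k])" using xz[of k] by (auto simp: cyls_def)
    moreover have "\<forall>d\<in>set (map z [0..<k]). d < n" using z by (auto simp: seqs_def)
    ultimately have "Q i (map x [0..<j])" using k unfolding Q_def by blast
    then show False using i by (auto simp: cyls_def)
  qed
  then show "\<exists>i. z \<notin> cyls (Collect (P i))" by blast
qed

text \<open>The words of length \<open>K\<close> that have already forced \<tau> and already entered
  the open set of \<open>P\<close>. Each contributes a cylinder of measure
  \<open>(1 / real m) ^ K\<close>, so counting them measures
  \<open>cyls (Collect P) \<inter> E \<tau>\<close> from below.\<close>

definition level_strings :: "(nat list \<Rightarrow> bool) \<Rightarrow> nat list \<Rightarrow> nat \<Rightarrow> nat list set" where
  "level_strings P \<tau> K = {\<sigma>. (\<forall>d\<in>set \<sigma>. d < m) \<and> length \<sigma> = K \<and> R \<sigma> \<tau> \<and> (\<exists>\<alpha> \<beta>. \<sigma> = \<alpha> @ \<beta> \<and> P \<alpha>)}"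

lemma finite_level_strings: "finite (level_strings P \<tau> K)"
proof -
  have "level_strings P \<tau> K \<subseteq> {\<sigma>. set \<sigma> \<subseteq> {..<m} \<and> length \<sigma> = K}"
    by (auto simp: level_strings_def)
  then show ?thesis by (rule finite_subset) (rule finite_lists_length_eq, simp)
qed

lemma measure_UN_cyl:
  assumes "finite D" "\<And>\<sigma>. \<sigma> \<in> D \<Longrightarrow> set \<sigma> \<subseteq> {..<k} \<and> length \<sigma> = K"
  shows "measure (unif k) (\<Union>\<sigma>\<in>D. cyl \<sigma>) = real (card D) * (1 / real k) ^ K"
proof -
  have "measure (unif k) (\<Union>\<sigma>\<in>D. cyl \<sigma>) = (\<Sum>\<sigma>\<in>D. measure (unif k) (cyl \<sigma>))"
  proof (rule unif.finite_measure_finite_Union)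
    show "disjoint_family_on cyl D"
      using assms(2) unfolding disjoint_family_on_def disjoint_iff cyl_iff by metis
  qed (auto simp: assms(1))
  also have "\<dots> = (\<Sum>\<sigma>\<in>D. (1 / real k) ^ K)"
    using assms(2) by (intro sum.cong) (auto simp: measure_cyl)
  finally show ?thesis by simp
qed

lemma UN_level_strings_subset: "(\<Union>\<sigma>\<in>level_strings P \<tau> K. cyl \<sigma>) \<subseteq> cyls (Collect P) \<inter> E \<tau>"
proof
  fix x assume "x \<in> (\<Union>\<sigma>\<in>level_strings P \<tau> K. cyl \<sigma>)"
  then obtain \<sigma> where "\<sigma> \<in> level_strings P \<tau> K" "map x [0..<length \<sigma>] = \<sigma>"
    by (auto simp: cyl_iff)
  moreover from this obtain \<alpha> \<beta> where "R \<sigma> \<tau>" "\<sigma> = \<alpha> @ \<beta>" "P \<alpha>"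
    unfolding level_strings_def by blast
  moreover have "take (length \<alpha>) (map x [0..<length \<sigma>]) = map x [0..<length \<alpha>]"
    unfolding take_prefix using \<open>\<sigma> = \<alpha> @ \<beta>\<close> by simp
  ultimately have "R (map x [0..<length \<sigma>]) \<tau>" "P (map x [0..<length \<alpha>])" by auto
  then show "x \<in> cyls (Collect P) \<inter> E \<tau>"
    unfolding cyls_def by blast
qed

lemma sets_UN_cyl: "(\<Union>\<sigma>\<in>D. cyl \<sigma>) \<in> sets (unif k)"
  by (rule sets.countable_UN') auto

text \<open>Having forced \<tau> and having met \<open>P\<close> both persist under extension, so
  the stages increase with \<open>K\<close>, and continuity from below carries the bound to their
  union. The intersection with \<open>seqs m\<close> matches the restriction of the words to digits
  below \<open>m\<close>.\<close>

lemma measure_Int_E_le: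
  assumes "\<And>K. real (card (level_strings P \<tau> K)) * (1 / real m) ^ K \<le> c"
  shows "measure (unif m) (cyls (Collect P) \<inter> E \<tau>) \<le> c"
proof -
  define A where "A K = seqs m \<inter> (\<Union>\<sigma>\<in>level_strings P \<tau> K. cyl \<sigma>)" for K
  have A_iff: "x \<in> A K \<longleftrightarrow> x \<in> seqs m \<and> R (map x [0..<K]) \<tau> \<and> (\<exists>j\<le>K. P (map x [0..<j]))" for x K
  proof -
    have "x \<in> A K \<longleftrightarrow> x \<in> seqs m \<and> map x [0..<K] \<in> level_strings P \<tau> K"
      unfolding A_def cyl_iff UN_iff by (auto simp: level_strings_def cyl_iff)
    also have "\<dots> \<longleftrightarrow> x \<in> seqs m \<and> R (map x [0..<K]) \<tau> \<and> (\<exists>\<alpha> \<beta>. map x [0..<K] = \<alpha> @ \<beta> \<and> P \<alpha>)"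
      by (auto simp: level_strings_def seqs_def)
    also have "(\<exists>\<alpha> \<beta>. map x [0..<K] = \<alpha> @ \<beta> \<and> P \<alpha>) \<longleftrightarrow> (\<exists>j\<le>K. P (map x [0..<j]))"
    proof
      assume "\<exists>\<alpha> \<beta>. map x [0..<K] = \<alpha> @ \<beta> \<and> P \<alpha>"
      then obtain \<alpha> \<beta> where *: "map x [0..<K] = \<alpha> @ \<beta>" "P \<alpha>" by blast
      then have "\<alpha> = take (length \<alpha>) (map x [0..<K])" by simp
      then show "\<exists>j\<le>K. P (map x [0..<j])"
        unfolding take_prefix using *(2) by (metis min.cobounded2)
    next
      assume "\<exists>j\<le>K. P (map x [0..<j])"
      then obtain j where j: "j \<le> K" "P (map x [0..<j])" by blast
      then have "map x [0..<j] = take j (map x [0..<K])" unfolding take_prefix by simp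
      with j(2) show "\<exists>\<alpha> \<beta>. map x [0..<K] = \<alpha> @ \<beta> \<and> P \<alpha>"
        by (metis append_take_drop_id)
    qed
    finally show ?thesis .
  qed
  have A_sets: "A K \<in> sets (unif m)" for K
    unfolding A_def by (intro sets.Int sets_seqs sets_UN_cyl)
  have "incseq A"
  proof (intro incseq_SucI subsetI)
    fix K x assume "x \<in> A K"
    then show "x \<in> A (Suc K)"
      unfolding A_iff using R_prefix_mono[of x K \<tau> "Suc K"] le_SucI by blast
  qed
  then have lim: "(\<lambda>K. measure (unif m) (A K)) \<longlonglongrightarrow> measure (unif m) (\<Union>K. A K)"
    using A_sets by (intro unif.finite_Lim_measure_incseq) auto
  have "measure (unif m) (A K) \<le> c" for K
  proof -
    have "measure (unif m) (A K) \<le> measure (unif m) (\<Union>\<sigma>\<in>level_strings P \<tau> K. cyl \<sigma>)"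
      unfolding A_def
      by (rule unif.finite_measure_mono[OF _ sets_UN_cyl]) blast
    also have "\<dots> = real (card (level_strings P \<tau> K)) * (1 / real m) ^ K"
      by (rule measure_UN_cyl[OF finite_level_strings]) (auto simp: level_strings_def)
    finally show ?thesis using assms[of K] by simp
  qed
  then have "measure (unif m) (\<Union>K. A K) \<le> c"
    by (intro LIMSEQ_le_const2[OF lim]) auto
  moreover have "cyls (Collect P) \<inter> E \<tau> \<inter> seqs m \<subseteq> (\<Union>K. A K)"
  proof
    fix x assume x: "x \<in> cyls (Collect P) \<inter> E \<tau> \<inter> seqs m"
    then obtain j k where "P (map x [0..<j])" "R (map x [0..<k]) \<tau>" by (auto simp: cyls_def)
    then have "x \<in> A (max j k)"
      using x unfolding A_iff by (auto intro: R_prefix_mono intro!: exI[of _ j])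
    then show "x \<in> (\<Union>K. A K)" by blast
  qed
  then have "measure (unif m) (cyls (Collect P) \<inter> E \<tau> \<inter> seqs m) \<le> measure (unif m) (\<Union>K. A K)"
    using A_sets by (intro unif.finite_measure_mono) auto
  ultimately show ?thesis
    using measure_Int_seqs[OF m_pos, of "cyls (Collect P) \<inter> E \<tau>"] by simp
qed

text \<open>\<open>heavy P i \<tau>\<close> expresses by finite means that \<open>cyls (Collect (P (2 * i)))\<close> fills more than the
  fraction \<open>1 / 2 ^ i\<close> of \<open>E \<tau>\<close>.\<close>

definition heavy :: "(nat \<Rightarrow> nat list \<Rightarrow> bool) \<Rightarrow> nat \<Rightarrow> nat list \<Rightarrow> bool" where
  "heavy P i \<tau> \<longleftrightarrow> (\<forall>d\<in>set \<tau>. d < n) \<and>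
     (\<exists>D K. distinct D \<and> (\<forall>\<sigma>\<in>set D. (\<forall>d\<in>set \<sigma>. d < m) \<and> length \<sigma> = K \<and> R \<sigma> \<tau> \<and>
        (\<exists>\<alpha> \<beta>. \<sigma> = \<alpha> @ \<beta> \<and> P (2 * i) \<alpha>)) \<and> m ^ K < length D * n ^ length \<tau> * 2 ^ i)"

text \<open>The inequality between naturals in \<open>heavy\<close> is the inequality between
  measures with its denominators cleared. The list \<open>D\<close> enumerates part of
  \<open>level_strings\<close>; the best choice is all of it, which turns the length of
  \<open>D\<close> into a cardinality.\<close>

lemma heavy_iff:
  "heavy P i \<tau> \<longleftrightarrow> (\<forall>d\<in>set \<tau>. d < n) \<and>
     (\<exists>K. (1 / 2 ^ i) * (1 / real n) ^ length \<tau> <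
        real (card (level_strings (P (2 * i)) \<tau> K)) * (1 / real m) ^ K)"
proof -
  have *: "m ^ K < c * n ^ l * 2 ^ i \<longleftrightarrow> (1 / 2 ^ i) * (1 / real n) ^ l < real c * (1 / real m) ^ K"
    for c K l
  proof -
    have "m ^ K < c * n ^ l * 2 ^ i \<longleftrightarrow> real m ^ K < real c * real n ^ l * 2 ^ i"
      by (subst of_nat_less_iff[where 'a = real, symmetric]) simp
    also have "\<dots> \<longleftrightarrow> (1 / 2 ^ i) * (1 / real n) ^ l < real c * (1 / real m) ^ K"
      using m_pos n_pos by (simp add: field_simps power_divide)
    finally show ?thesis .
  qed
  have "(\<exists>D K. distinct D \<and> (\<forall>\<sigma>\<in>set D. (\<forall>d\<in>set \<sigma>. d < m) \<and> length \<sigma> = K \<and> R \<sigma> \<tau> \<and>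
        (\<exists>\<alpha> \<beta>. \<sigma> = \<alpha> @ \<beta> \<and> P (2 * i) \<alpha>)) \<and> m ^ K < length D * n ^ length \<tau> * 2 ^ i) \<longleftrightarrow>
     (\<exists>K D. distinct D \<and> set D \<subseteq> level_strings (P (2 * i)) \<tau> K \<and>
        m ^ K < length D * n ^ length \<tau> * 2 ^ i)"
    unfolding level_strings_def subset_iff mem_Collect_eq by blast
  also have "\<dots> \<longleftrightarrow> (\<exists>K. m ^ K < card (level_strings (P (2 * i)) \<tau> K) * n ^ length \<tau> * 2 ^ i)"
  proof (intro ex_cong1 iffI)
    fix K assume "\<exists>D. distinct D \<and> set D \<subseteq> level_strings (P (2 * i)) \<tau> K \<and>
        m ^ K < length D * n ^ length \<tau> * 2 ^ i"
    then obtain D where D: "distinct D" "set D \<subseteq> level_strings (P (2 * i)) \<tau> K"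
      "m ^ K < length D * n ^ length \<tau> * 2 ^ i" by blast
    have "length D \<le> card (level_strings (P (2 * i)) \<tau> K)"
      using D(1,2) card_mono[OF finite_level_strings] by (metis distinct_card)
    then show "m ^ K < card (level_strings (P (2 * i)) \<tau> K) * n ^ length \<tau> * 2 ^ i"
      using D(3) by (meson less_le_trans mult_le_mono1)
  next
    fix K assume "m ^ K < card (level_strings (P (2 * i)) \<tau> K) * n ^ length \<tau> * 2 ^ i"
    then show "\<exists>D. distinct D \<and> set D \<subseteq> level_strings (P (2 * i)) \<tau> K \<and>
        m ^ K < length D * n ^ length \<tau> * 2 ^ i"
      using finite_distinct_list[OF finite_level_strings] by (metis distinct_card order_refl)
  qed
  finally show ?thesis unfolding heavy_def * by blast
qed

text \<open>Ville's inequality with threshold \<open>c = 1 / 2 ^ (i + s)\<close> bounds the measure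
  by that of level \<open>2 * (i + s)\<close> divided by \<open>c\<close>, and this is at most
  \<open>c\<close> again: hence the doubled index in \<open>heavy\<close>. The shift
  \<open>s\<close> allows a level of index at least \<open>s\<close> to be selected later.\<close>

lemma test_heavy:
  assumes P: "test m P"
  shows "test n (\<lambda>i. heavy P (i + s))"
  unfolding test_def
proof (intro conjI allI)
  have sP: "semidec (\<lambda>p. P (fst p) (snd p))" using P by (simp add: test_def)
  show "semidec (\<lambda>p. heavy P (fst p + s) (snd p))"
    unfolding heavy_def
    by (intro semidec_ex semidec_conj semidec_ball semidec_comp2[OF sP] semidec_comp2[OF semidec_R]
        semidec_decidable[OF decidable_ball] semidec_decidable[OF decidable_distinct]
        semidec_decidable[OF decidable_less] semidec_decidable[OF decidable_eq] computable_intros)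
  fix i
  define c :: real where "c = 1 / 2 ^ (i + s)"
  have c: "0 < c" by (simp add: c_def)
  have "c * measure (unif n) (cyls (Collect (heavy P (i + s)))) \<le>
      measure (unif m) (cyls (Collect (P (2 * (i + s)))))"
  proof (rule measure_cyls_le)
    fix \<tau> assume "\<tau> \<in> Collect (heavy P (i + s))"
    then obtain K where K: "c * (1 / real n) ^ length \<tau> <
        real (card (level_strings (P (2 * (i + s))) \<tau> K)) * (1 / real m) ^ K"
      unfolding heavy_iff c_def by blast
    also have "\<dots> = measure (unif m) (\<Union>\<sigma>\<in>level_strings (P (2 * (i + s))) \<tau> K. cyl \<sigma>)"
      by (rule measure_UN_cyl[OF finite_level_strings, symmetric]) (auto simp: level_strings_def)
    also have "\<dots> \<le> measure (unif m) (cyls (Collect (P (2 * (i + s)))) \<inter> E \<tau>)"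
      by (rule unif.finite_measure_mono[OF UN_level_strings_subset]) auto
    finally show "c * (1 / real n) ^ length \<tau> \<le>
        measure (unif m) (cyls (Collect (P (2 * (i + s)))) \<inter> E \<tau>)" by simp
  qed (use c in \<open>auto simp: heavy_def\<close>)
  also have "\<dots> \<le> 1 / 2 ^ (2 * (i + s))" using P by (simp add: test_def)
  also have "\<dots> = c * c" by (simp add: c_def mult_2 power_add)
  finally have "measure (unif n) (cyls (Collect (heavy P (i + s)))) \<le> c"
    using c by simp
  also have "c \<le> 1 / 2 ^ i" by (simp add: c_def power_add field_simps)
  finally show "measure (unif n) (cyls (Collect (heavy P (i + s)))) \<le> 1 / 2 ^ i" .
qed

theorem random_preimage:
  assumes z: "martin_loef_random n z"
    and total: "\<And>x. martin_loef_random m x \<Longrightarrow> \<exists>z\<in>seqs n. \<forall>k. x \<in> E (map z [0..<k])"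
  shows "\<exists>x. martin_loef_random m x \<and> (\<forall>k. x \<in> E (map z [0..<k]))"
proof -
  have zs: "z \<in> seqs n" using z by (simp add: martin_loef_random_iff)
  have zk: "set (map z [0..<k]) \<subseteq> {..<n}" for k using zs by (auto simp: seqs_def)
  \<comment> \<open>\<open>from_nat_into\<close> has a countable set as its range once the set is
    not empty; the test with empty levels provides an element.\<close>
  have "semidec (\<lambda>p :: nat \<times> nat list. False)"
    by (rule semidec_decidable) (simp add: decidable_def computable_const)
  then have "test m (\<lambda>_ _. False)"
    by (simp add: test_def cyls_def)
  then have "range (from_nat_into (Collect (test m))) = Collect (test m)"
    by (intro range_from_nat_into countable_tests) blast
  then obtain e :: "nat \<Rightarrow> nat \<Rightarrow> nat list \<Rightarrow> bool" where e: "Collect (test m) = range e"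
    by metis
  have te: "test m (e j)" for j using e by blast
  \<comment> \<open>With \<open>i\<close> at least \<open>j + 2\<close> the shares are at most 1/4,
    1/8, 1/16, ..., which add up to 1/2. The level depends on \<open>j\<close> but not on a prefix
    of \<open>z\<close>, so a single open set \<open>U\<close> serves for all prefixes.\<close>
  have "\<exists>i\<ge>j + 2. z \<notin> cyls (Collect (heavy (e j) i))" for j
  proof -
    obtain i where "z \<notin> cyls (Collect (heavy (e j) (i + (j + 2))))"
      using z test_heavy[OF te, of j "j + 2"] unfolding martin_loef_random_iff by blast
    then show ?thesis by (intro exI[of _ "i + (j + 2)"]) simp
  qed
  then obtain h where h: "\<And>j. j + 2 \<le> h j" "\<And>j. z \<notin> cyls (Collect (heavy (e j) (h j)))"
    by metis
  define U where "U = (\<Union>j. cyls (Collect (e j (2 * h j))))"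
  have U_sets: "U \<in> sets (unif m)" unfolding U_def by (intro sets.countable_UN) auto
  have "\<exists>x. x \<in> E (map z [0..<k]) \<and> x \<in> seqs m \<and> x \<notin> U" for k
  proof (rule ccontr)
    let ?E = "E (map z [0..<k])" and ?q = "(1 / real n) ^ k"
    assume "\<not> ?thesis"
    then have "?E \<inter> seqs m \<subseteq> U \<inter> ?E" by blast
    then have "measure (unif m) (?E \<inter> seqs m) \<le> measure (unif m) (U \<inter> ?E)"
      using U_sets by (intro unif.finite_measure_mono) auto
    then have lower: "?q \<le> measure (unif m) (U \<inter> ?E)"
      using measure_Int_seqs[OF m_pos, of ?E] measure_R[OF zk, of k] by simp
    have le: "measure (unif m) (cyls (Collect (e j (2 * h j))) \<inter> ?E) \<le> (1 / 2) ^ j * (?q / 4)" for j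
    proof -
      have "\<not> heavy (e j) (h j) (map z [0..<k])" using h(2)[of j] by (auto simp: cyls_def)
      then have "real (card (level_strings (e j (2 * h j)) (map z [0..<k]) K)) * (1 / real m) ^ K \<le>
          (1 / 2 ^ h j) * ?q" for K
        using zk[of k] unfolding heavy_iff by (auto simp: not_less)
      then have "measure (unif m) (cyls (Collect (e j (2 * h j))) \<inter> ?E) \<le> (1 / 2 ^ h j) * ?q"
        by (rule measure_Int_E_le)
      also have "\<dots> \<le> (1 / 2 ^ (j + 2)) * ?q"
        using h(1)[of j] by (intro mult_right_mono divide_left_mono power_increasing) auto
      finally show ?thesis by (simp add: power_divide)
    qed
    have sum: "(\<lambda>j. (1 / 2) ^ j * (?q / 4)) sums (1 / (1 - 1 / 2) * (?q / 4))"
      by (intro sums_mult2 geometric_sums) simp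
    have summ: "summable (\<lambda>j. measure (unif m) (cyls (Collect (e j (2 * h j))) \<inter> ?E))"
      by (rule summable_comparison_test'[OF sums_summable[OF sum], of 0]) (use le in auto)
    have "U \<inter> ?E = (\<Union>j. cyls (Collect (e j (2 * h j))) \<inter> ?E)" by (auto simp: U_def)
    also have "measure (unif m) \<dots> \<le> (\<Sum>j. measure (unif m) (cyls (Collect (e j (2 * h j))) \<inter> ?E))"
      by (rule unif.finite_measure_subadditive_countably[OF _ summ]) auto
    also have "\<dots> \<le> (\<Sum>j. (1 / 2) ^ j * (?q / 4))"
      by (rule suminf_le[OF le summ sums_summable[OF sum]])
    also have "\<dots> = ?q / 2" using sums_unique[OF sum] by simp
    finally have "measure (unif m) (U \<inter> ?E) \<le> ?q / 2" .
    moreover have "0 < ?q" using n_pos by simp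
    ultimately show False using lower by linarith
  qed
  then obtain y where y: "\<And>k. y k \<in> E (map z [0..<k])" "\<And>k. y k \<in> seqs m" "\<And>k. y k \<notin> U"
    by metis
  obtain x and r :: "nat \<Rightarrow> nat" where x: "x \<in> seqs m" and r: "strict_mono r"
    and ev: "\<And>k. \<forall>\<^sub>F j in sequentially. map (y (r j)) [0..<k] = map x [0..<k]"
    using seqs_convergent_subseq[of y m, OF y(2)] by blast
  \<comment> \<open>\<open>U\<close> is open: a prefix that put \<open>x\<close> into
    \<open>U\<close> would be shared by some \<open>y (r l)\<close>, which avoids
    \<open>U\<close>.\<close>
  have "x \<notin> U"
  proof
    assume "x \<in> U"
    then obtain j k where jk: "e j (2 * h j) (map x [0..<k])" by (auto simp: U_def cyls_def)
    obtain l where l: "map (y (r l)) [0..<k] = map x [0..<k]"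
      using eventually_happens[OF ev[of k]] by auto
    have "y (r l) \<in> cyls (Collect (e j (2 * h j)))"
      by (rule cylsI[of _ k]) (simp only: l jk mem_Collect_eq)
    then have "y (r l) \<in> U" unfolding U_def by blast
    then show False using y(3) by blast
  qed
  then have "x \<notin> cyls (Collect (e j (2 * h j)))" for j by (auto simp: U_def)
  then have "\<exists>i. x \<notin> cyls (Collect (P i))" if "test m P" for P
    using that e by (metis mem_Collect_eq imageE)
  with x have random: "martin_loef_random m x"
    unfolding martin_loef_random_iff by blast
  \<comment> \<open>Membership in the open sets \<open>E (map z [0..<k])\<close> does not pass to
    the limit by itself. Being random, \<open>x\<close> has some image \<open>z'\<close>, and this
    image is now compared with \<open>z\<close>.\<close>
  then obtain z' where z': "\<And>k. x \<in> E (map z' [0..<k])" using total by blast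
  have "map z' [0..<k] = map z [0..<k]" for k
  proof -
    obtain l where l: "R (map x [0..<l]) (map z' [0..<k])" using z'[of k] by (auto simp: cyls_def)
    have "\<forall>\<^sub>F j in sequentially. map (y (r j)) [0..<l] = map x [0..<l] \<and> k \<le> j"
      by (intro eventually_conj ev eventually_ge_at_top)
    then obtain j where j: "map (y (r j)) [0..<l] = map x [0..<l]" "k \<le> j"
      using eventually_happens[of _ sequentially] trivial_limit_sequentially by blast
    have "y (r j) \<in> E (map z' [0..<k])"
      by (rule cylsI[of _ l]) (simp only: l j(1) mem_Collect_eq)
    moreover have "k \<le> r j" using j(2) seq_suble[OF r] le_trans by blast
    \<comment> \<open>\<open>y (r j)\<close> lies in \<open>E\<close> both of a prefix of
      \<open>z'\<close> and of the prefix of \<open>z\<close> of length \<open>r j\<close>, which is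
      at least as long, so the former is an initial segment of the latter.\<close>
    ultimately have "map z' [0..<k] = take (length (map z' [0..<k])) (map z [0..<r j])"
      by (intro E_unique[OF _ y(1)]) simp_all
    then show ?thesis using \<open>k \<le> r j\<close> by (simp add: take_prefix)
  qed
  with random z' show ?thesis by metis
qed

end

section \<open>Labels of columns and trees\<close>

text \<open>Strings are replaced by their length-lexicographic indices. As in a binary heap, the
  children of index \<open>q\<close> are \<open>2 * q + 1\<close> and \<open>2 * q + 2\<close>. The
  index is also the number of the column attached to the node.\<close>

definition kids_idx :: "nat \<Rightarrow> nat \<Rightarrow> nat list" where
  "kids_idx d q = (if d = 0 then [2 * q + 1] else if d = 1 then [2 * q + 2] else [2 * q + 1, 2 * q + 2])"

text \<open>The length-lexicographic order lists the nodes of the tree in breadth-first order: \<open>bfs z i\<close> is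
  the queue of node indices after \<open>i\<close> nodes have been expanded, and \<open>node z i\<close> is expanded next.\<close>

fun bfs :: "(nat \<Rightarrow> nat) \<Rightarrow> nat \<Rightarrow> nat list" where
  "bfs z 0 = [0]"
| "bfs z (Suc i) = bfs z i @ kids_idx (z i) (bfs z i ! i)"

definition node :: "(nat \<Rightarrow> nat) \<Rightarrow> nat \<Rightarrow> nat" where
  "node z i = bfs z i ! i"

lemma bfs_cong: "(\<And>j. j < i \<Longrightarrow> z j = z' j) \<Longrightarrow> bfs z i = bfs z' i"
  by (induction i) auto

lemma node_cong: "(\<And>j. j < i \<Longrightarrow> z j = z' j) \<Longrightarrow> node z i = node z' i"
  unfolding node_def using bfs_cong by metis

text \<open>The last clause keeps the queue sorted: if \<open>p\<close> is expanded next, every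
  entry is below \<open>2 * p + 1\<close>, hence below the new children. They are at most
  \<open>2 * p + 2\<close>, and the following node exceeds \<open>p\<close>, so the clause survives.
  The queue never runs empty because every node has a child.\<close>

lemma bfs_invariant:
  "sorted_wrt (<) (bfs z i) \<and> i < length (bfs z i) \<and> (\<forall>q\<in>set (bfs z i). q < 2 * (bfs z i ! i) + 1)"
proof (induction i)
  case 0
  show ?case by simp
next
  case (Suc i)
  let ?B = "bfs z i" and ?C = "bfs z (Suc i)"
  have kids: "\<forall>q\<in>set (kids_idx d p). 2 * p + 1 \<le> q \<and> q \<le> 2 * p + 2" "sorted_wrt (<) (kids_idx d p)"
    "kids_idx d p \<noteq> []" for d p
    by (auto simp: kids_idx_def)
  have sorted: "sorted_wrt (<) ?C"
    using Suc kids(1)[of "z i" "?B ! i"] kids(2) by (fastforce simp: sorted_wrt_append)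
  have len: "Suc i < length ?C"
    using Suc kids(3)[of "z i" "?B ! i"] by (cases "kids_idx (z i) (?B ! i)") auto
  have "?C ! i < ?C ! Suc i"
    by (rule sorted_wrt_nth_less[OF sorted _ len]) simp
  moreover have "?C ! i = ?B ! i" using Suc by (simp add: nth_append)
  moreover have "\<forall>q\<in>set ?C. q \<le> 2 * (?B ! i) + 2"
    using Suc kids(1)[of "z i" "?B ! i"] by fastforce
  ultimately show ?case using sorted len by fastforce
qed

lemma length_bfs: "i < length (bfs z i)"
  using bfs_invariant by blast

lemma nth_bfs:
  assumes "i \<le> j"
  shows "p < length (bfs z i) \<Longrightarrow> bfs z j ! p = bfs z i ! p \<and> p < length (bfs z j)"
  using assms
proof (induction j rule: dec_induct)
  case (step j)
  then show ?case by (simp add: nth_append)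
qed simp

text \<open>The queue is increasing, and an entry keeps its place once it is there. What matters
  later is injectivity: distinct nodes read distinct, hence independent, columns.\<close>

lemma strict_mono_node: "strict_mono (node z)"
proof (rule strict_monoI)
  fix i j :: nat assume "i < j"
  then have "bfs z j ! i = node z i"
    unfolding node_def using nth_bfs[of i j i z] length_bfs by simp
  moreover have "bfs z j ! i < bfs z j ! j"
    using \<open>i < j\<close> bfs_invariant[of z j] by (intro sorted_wrt_nth_less) auto
  ultimately show "node z i < node z j" by (simp add: node_def)
qed

text \<open>The label of a column \<open>y\<close> of bits is read off at the first position \<open>k\<close> with \<open>y k = y (Suc k)\<close>, the
  first place where \<open>y\<close> leaves the binary expansions \<open>0101...\<close> of 1/3 and \<open>1010...\<close> of 2/3.\<close>

definition label_at :: "(nat \<Rightarrow> nat) \<Rightarrow> nat \<Rightarrow> nat \<Rightarrow> bool" where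
  "label_at y k d \<longleftrightarrow> (\<forall>j<k. y j \<noteq> y (Suc j)) \<and> y k = y (Suc k) \<and>
     d = (if y k = y 0 then 1 - y 0 else 2)"

text \<open>The label of a bit sequence is the digit required in the code of the tree: 1 below 1/3,
  where only child 1 has conditional measure above 1/3; 0 above 2/3, where only child 0 has; 2 in
  between, where both have. A sequence that alternates forever has no label.\<close>

definition label :: "(nat \<Rightarrow> nat) \<Rightarrow> nat \<Rightarrow> bool" where
  "label y d \<longleftrightarrow> (\<exists>k. label_at y k d)"

lemma label_at_unique:
  assumes "label_at y k d" "label_at y k' d'"
  shows "k = k'" "d = d'"
proof -
  show "k = k'"
    using assms unfolding label_at_def by (metis linorder_neqE_nat)
  then show "d = d'" using assms unfolding label_at_def by simp
qed

lemma label_unique: "label y d \<Longrightarrow> label y d' \<Longrightarrow> d = d'"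
  unfolding label_def using label_at_unique by blast

lemma label_at_cong:
  assumes "\<And>j. j \<le> Suc k \<Longrightarrow> y j = y' j"
  shows "label_at y k d \<longleftrightarrow> label_at y' k d"
proof -
  have "y j = y' j" if "j < k" for j using assms[of j] that by simp
  moreover have "y (Suc j) = y' (Suc j)" if "j < k" for j using assms[of "Suc j"] that by simp
  moreover have "y k = y' k" "y (Suc k) = y' (Suc k)" "y 0 = y' 0" using assms by simp_all
  ultimately show ?thesis unfolding label_at_def by simp
qed

lemma ex_label:
  assumes "y k = y (Suc k)"
  shows "\<exists>d<3. label y d"
proof -
  define l where "l = (LEAST k. y k = y (Suc k))"
  have "y l = y (Suc l)" unfolding l_def by (rule LeastI[of "\<lambda>k. y k = y (Suc k)", OF assms])
  moreover have "y j \<noteq> y (Suc j)" if "j < l" for j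
    using not_less_Least[of j "\<lambda>k. y k = y (Suc k)"] that unfolding l_def by blast
  ultimately have "label_at y l (if y l = y 0 then 1 - y 0 else 2)"
    unfolding label_at_def by simp
  then show ?thesis unfolding label_def by (intro exI[of _ "if y l = y 0 then 1 - y 0 else 2"]) auto
qed

section \<open>The distribution of the label\<close>

lemma alternating_iff:
  assumes "y \<in> seqs 2"
  shows "(\<forall>j<k. y j \<noteq> y (Suc j)) \<longleftrightarrow> (\<forall>j\<le>k. y j = (y 0 + j) mod 2)"
proof (induction k)
  case 0
  have "y 0 < 2" using assms by (simp add: seqs_def)
  then show ?case by simp
next
  case (Suc k)
  have flip: "u \<noteq> v \<longleftrightarrow> v = Suc a mod 2" if "u = a mod 2" "v < 2" for u v a :: nat
    using that by presburger
  have "y (Suc k) < 2" using assms by (simp add: seqs_def)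
  then have step: "y k \<noteq> y (Suc k) \<longleftrightarrow> y (Suc k) = (y 0 + Suc k) mod 2" if "y k = (y 0 + k) mod 2"
    using flip[OF that] by simp
  have "(\<forall>j<Suc k. y j \<noteq> y (Suc j)) \<longleftrightarrow> (\<forall>j\<le>k. y j = (y 0 + j) mod 2) \<and> y k \<noteq> y (Suc k)"
    unfolding Suc.IH[symmetric] less_Suc_eq by blast
  also have "\<dots> \<longleftrightarrow> (\<forall>j\<le>k. y j = (y 0 + j) mod 2) \<and> y (Suc k) = (y 0 + Suc k) mod 2"
    using step by blast
  also have "\<dots> \<longleftrightarrow> (\<forall>j\<le>Suc k. y j = (y 0 + j) mod 2)"
    unfolding le_Suc_eq by blast
  finally show ?case .
qed

text \<open>Read up to position \<open>Suc k\<close>, for a bit \<open>b\<close>: the alternating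
  word of length \<open>k + 1\<close> that begins with \<open>b\<close>, followed by a copy of its
  last bit.\<close>

definition repeat_pattern :: "nat \<Rightarrow> nat \<Rightarrow> nat \<Rightarrow> nat" where
  "repeat_pattern b k j = (if j \<le> k then (b + j) mod 2 else (b + k) mod 2)"

text \<open>The first \<open>k + 2\<close> bits are determined by \<open>k\<close> and the first
  bit. The alternating word ends with the bit it began with exactly when \<open>k\<close> is even,
  so the case distinction on \<open>y k = y 0\<close> becomes one on parity.\<close>

lemma label_at_iff_pattern:
  assumes "y \<in> seqs 2"
  shows "label_at y k d \<longleftrightarrow> (\<exists>b<2. d = (if even k then 1 - b else 2) \<and>
    (\<forall>j\<in>{..Suc k}. y j = repeat_pattern b k j))"
proof -
  have y: "y j < 2" for j using assms by (simp add: seqs_def)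
  have parity: "(b + k) mod 2 = b \<longleftrightarrow> even k" if "b < 2" for b
    using that by presburger
  have "label_at y k d \<longleftrightarrow> (\<forall>j\<le>k. y j = (y 0 + j) mod 2) \<and> y k = y (Suc k) \<and>
      d = (if y k = y 0 then 1 - y 0 else 2)"
    unfolding label_at_def alternating_iff[OF assms] by (rule refl)
  also have "\<dots> \<longleftrightarrow> (\<forall>j\<le>k. y j = (y 0 + j) mod 2) \<and> y (Suc k) = (y 0 + k) mod 2 \<and>
      d = (if even k then 1 - y 0 else 2)"
  proof (rule conj_cong[OF refl])
    assume "\<forall>j\<le>k. y j = (y 0 + j) mod 2"
    then have yk: "y k = (y 0 + k) mod 2" by blast
    show "(y k = y (Suc k) \<and> d = (if y k = y 0 then 1 - y 0 else 2)) \<longleftrightarrow>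
        y (Suc k) = (y 0 + k) mod 2 \<and> d = (if even k then 1 - y 0 else 2)"
      unfolding yk parity[OF y[of 0]] by (rule conj_cong[OF eq_commute refl])
  qed
  also have "\<dots> \<longleftrightarrow> (\<forall>j\<in>{..Suc k}. y j = repeat_pattern (y 0) k j) \<and>
      d = (if even k then 1 - y 0 else 2)"
    by (auto simp: repeat_pattern_def atMost_Suc)
  finally have "label_at y k d \<longleftrightarrow> (\<forall>j\<in>{..Suc k}. y j = repeat_pattern (y 0) k j) \<and>
      d = (if even k then 1 - y 0 else 2)" by blast
  moreover have "y 0 = b" if "\<forall>j\<in>{..Suc k}. y j = repeat_pattern b k j" "b < 2" for b
    using that by (auto simp: repeat_pattern_def)
  ultimately show ?thesis using y[of 0] by blast
qed

lemma measure_pattern: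
  "measure (unif 2) {y. \<forall>j\<in>{..Suc k}. y j = repeat_pattern b k j} = (1 / 2) ^ (k + 2)"
  using measure_unif_coords[of "{..Suc k}" "repeat_pattern b k" 2] by (simp add: repeat_pattern_def)

lemma sets_label_at [measurable]: "{y. label_at y k d} \<in> sets (unif m)"
proof -
  have "{y \<in> space (unif m). (\<forall>j<k. y j \<noteq> y (Suc j)) \<and> y k = y (Suc k) \<and>
     d = (if y k = y 0 then 1 - y 0 else 2)} \<in> sets (unif m)"
    by measurable
  then show ?thesis by (simp add: label_at_def)
qed

lemma sets_label [measurable]: "{y. label y d} \<in> sets (unif m)"
proof -
  have "{y. label y d} = (\<Union>k. {y. label_at y k d})" by (auto simp: label_def)
  then show ?thesis by (simp add: sets.countable_UN sets_label_at)
qed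

text \<open>There are two patterns of \<open>k + 2\<close> bits, one for each first bit. For even
  \<open>k\<close> the one beginning with 1 has label 0 and the one beginning with 0 has label 1;
  for odd \<open>k\<close> both have label 2.\<close>

lemma measure_label_at:
  assumes "d < 3"
  shows "measure (unif 2) {y. label_at y k d} =
    (if d < 2 then if even k then (1 / 2) ^ (k + 2) else 0 else if even k then 0 else (1 / 2) ^ (k + 1))"
proof -
  define A where "A b = {y. \<forall>j\<in>{..Suc k}. y j = repeat_pattern b k j}" for b
  have sets: "A b \<in> sets (unif 2)" for b
  proof -
    have "{y \<in> space (unif 2). \<forall>j\<in>{..Suc k}. y j = repeat_pattern b k j} \<in> sets (unif 2)"
      by measurable
    then show ?thesis by (simp add: A_def)
  qed
  have A: "measure (unif 2) (A b) = (1 / 2) ^ (k + 2)" for b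
    unfolding A_def by (rule measure_pattern)
  have "A 0 \<inter> A 1 = {}" by (auto simp: A_def repeat_pattern_def intro!: bexI[of _ 0])
  then have A_Un: "measure (unif 2) (A 0 \<union> A 1) = (1 / 2) ^ (k + 1)"
    using unif.finite_measure_Union[OF sets[of 0] sets[of 1]] by (simp add: A)
  let ?B = "(if d = (if even k then 1 else 2) then A 0 else {}) \<union>
    (if d = (if even k then 0 else 2) then A 1 else {})"
  have less2: "(\<exists>b<2. Q b) \<longleftrightarrow> Q 0 \<or> Q (1::nat)" for Q by (auto simp: less_2_cases_iff)
  have "{y. label_at y k d} \<inter> seqs 2 = ?B \<inter> seqs 2"
    by (auto simp: label_at_iff_pattern less2 A_def)
  then have eq: "measure (unif 2) {y. label_at y k d} = measure (unif 2) ?B"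
    using measure_Int_seqs[of 2 "{y. label_at y k d}"] measure_Int_seqs[of 2 ?B] sets by simp
  consider "d = 0" | "d = 1" | "d = 2" using assms by linarith
  then show ?thesis
  proof cases
    case 1
    then show ?thesis unfolding eq by (cases "even k") (simp_all add: A del: One_nat_def)
  next
    case 2
    then show ?thesis unfolding eq by (cases "even k") (simp_all add: A del: One_nat_def)
  next
    case 3
    then show ?thesis unfolding eq by (cases "even k") (simp_all add: A_Un del: One_nat_def)
  qed
qed

text \<open>Only even positions contribute to labels 0 and 1, only odd ones to label 2;
  \<open>f\<close> enumerates the relevant positions. In each case the contributions are 1/4, 1/16,
  1/64, ..., with sum 1/3.\<close>

lemma measure_label:
  assumes "d < 3"
  shows "measure (unif 2) {y. label y d} = 1 / 3"
proof -
  define f where "f i = (if d < 2 then 2 * i else Suc (2 * i))" for i :: nat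
  have f: "measure (unif 2) {y. label_at y (f i) d} = (1 / 4) * (1 / 4) ^ i" for i
    using measure_label_at[OF assms, of "f i"]
    by (simp add: f_def power_mult power_divide)
  have zero: "measure (unif 2) {y. label_at y k d} = 0" if "k \<notin> range f" for k
  proof -
    have "odd k" if "d < 2" using \<open>k \<notin> range f\<close> that by (auto simp: f_def elim!: evenE)
    moreover have "even k" if "\<not> d < 2"
    proof (rule ccontr)
      assume "odd k"
      then obtain j where "k = 2 * j + 1" by (rule oddE)
      with that have "k = f j" by (simp add: f_def)
      then show False using \<open>k \<notin> range f\<close> by blast
    qed
    ultimately show ?thesis using measure_label_at[OF assms, of k] by auto
  qed
  have "strict_mono f" by (rule strict_monoI) (simp add: f_def)
  have "(\<lambda>k. measure (unif 2) {y. label_at y k d}) sums measure (unif 2) (\<Union>k. {y. label_at y k d})"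
    using label_at_unique(1) by (intro unif.finite_measure_UNION) (auto simp: disjoint_family_on_def)
  then have "(\<lambda>i. measure (unif 2) {y. label_at y (f i) d}) sums measure (unif 2) (\<Union>k. {y. label_at y k d})"
    using sums_mono_reindex[OF \<open>strict_mono f\<close>, of "\<lambda>k. measure (unif 2) {y. label_at y k d}"] zero by blast
  moreover have "(\<lambda>i. measure (unif 2) {y. label_at y (f i) d}) sums (1 / 3)"
    unfolding f using sums_mult[OF geometric_sums[of "1 / 4 :: real"], of "1 / 4"] by simp
  moreover have "{y. label y d} = (\<Union>k. {y. label_at y k d})" by (auto simp: label_def)
  ultimately show ?thesis using sums_unique2 by metis
qed

section \<open>Labels and tree codes forced by finite strings\<close>

definition string_label :: "nat list \<Rightarrow> nat \<Rightarrow> nat \<Rightarrow> bool" where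
  "string_label \<sigma> q d \<longleftrightarrow> (\<exists>k. prod_encode (q, Suc k) < length \<sigma> \<and>
     label_at (\<lambda>j. nth0 \<sigma> (prod_encode (q, j))) k d)"

text \<open>This makes the single length bound in \<open>string_label\<close> sufficient: if
  \<sigma> reaches bit \<open>Suc k\<close> of column \<open>q\<close>, the earlier bits of that
  column are also genuine entries of \<sigma>, not default values of \<open>nth0\<close>.\<close>

lemma prod_encode_mono: "j \<le> k \<Longrightarrow> prod_encode (q, j) \<le> prod_encode (q, k)"
  by (simp add: prod_encode_def triangle_mono)

lemma nth0_append: "i < length \<sigma> \<Longrightarrow> nth0 (\<sigma> @ \<rho>) i = nth0 \<sigma> i"
  by (simp add: nth_append)

lemma string_label_append: "string_label \<sigma> q d \<Longrightarrow> string_label (\<sigma> @ \<rho>) q d"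
proof -
  assume "string_label \<sigma> q d"
  then obtain k where k: "prod_encode (q, Suc k) < length \<sigma>"
    "label_at (\<lambda>j. nth0 \<sigma> (prod_encode (q, j))) k d"
    unfolding string_label_def by blast
  have "label_at (\<lambda>j. nth0 (\<sigma> @ \<rho>) (prod_encode (q, j))) k d"
    using k(2) nth0_append[OF le_less_trans[OF prod_encode_mono k(1)]]
    by (subst label_at_cong[where y' = "\<lambda>j. nth0 \<sigma> (prod_encode (q, j))"]) auto
  with k(1) show ?thesis unfolding string_label_def by (intro exI[of _ k]) simp
qed

lemma label_column_iff: "label (bit_column q x) d \<longleftrightarrow> (\<exists>l. string_label (map x [0..<l]) q d)"
proof -
  have *: "label_at (\<lambda>j. nth0 (map x [0..<l]) (prod_encode (q, j))) k d \<longleftrightarrow> label_at (bit_column q x) k d"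
    if "prod_encode (q, Suc k) < l" for k l
  proof (rule label_at_cong)
    fix j assume "j \<le> Suc k"
    then have "prod_encode (q, j) < l" using prod_encode_mono that le_less_trans by blast
    then show "nth0 (map x [0..<l]) (prod_encode (q, j)) = bit_column q x j"
      by (simp add: bit_column_def)
  qed
  show ?thesis
  proof
    assume "label (bit_column q x) d"
    then obtain k where "label_at (bit_column q x) k d" unfolding label_def by blast
    then have "string_label (map x [0..<Suc (prod_encode (q, Suc k))]) q d"
      unfolding string_label_def by (intro exI[of _ k]) (simp add: * del: upt_Suc)
    then show "\<exists>l. string_label (map x [0..<l]) q d" by blast
  next
    assume "\<exists>l. string_label (map x [0..<l]) q d"
    then show "label (bit_column q x) d"
      unfolding string_label_def label_def using * by auto
  qed
qed

text \<open>The relation \<sigma> determines the code up to \<tau>. The zeros by which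
  \<open>nth0 \<tau>\<close> continues \<tau> are never seen, since node \<open>i\<close> depends
  only on the digits before \<open>i\<close>.\<close>

definition forces :: "nat list \<Rightarrow> nat list \<Rightarrow> bool" where
  "forces \<sigma> \<tau> \<longleftrightarrow> (\<forall>i<length \<tau>. string_label \<sigma> (node (nth0 \<tau>) i) (nth0 \<tau> i))"

text \<open>The shape that \<open>computable_rec\<close> asks for. The queue always has an entry at
  the position read, so \<open>nth0\<close> may replace \<open>!\<close>.\<close>

lemma bfs_eq_rec: "bfs z i = rec_nat [0] (\<lambda>i B. B @ kids_idx (z i) (nth0 B i)) i"
proof (induction i)
  case (Suc i)
  then show ?case using length_bfs[of i z] by simp
qed simp

lemma computable_node:
  assumes "computable f" "computable g"
  shows "computable (\<lambda>a. node (nth0 (f a)) (g a))"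
proof -
  have "computable (\<lambda>a. nth0 (rec_nat [0]
      (\<lambda>i B. B @ kids_idx (nth0 (f a) i) (nth0 B i)) (g a)) (g a))"
    unfolding kids_idx_def
    by (intro computable_intros assms computable_o_fst[OF assms(1)])
  moreover have "nth0 (rec_nat [0] (\<lambda>i B. B @ kids_idx (z i) (nth0 B i)) i) i = node z i" for z i
    unfolding bfs_eq_rec[symmetric] node_def using length_bfs by simp
  ultimately show ?thesis by simp
qed

lemma semidec_string_label:
  assumes "computable f" "computable g" "computable h"
  shows "semidec (\<lambda>a. string_label (f a) (g a) (h a))"
proof -
  have "semidec (\<lambda>p. string_label (fst p) (fst (snd p)) (snd (snd p)))"
    unfolding string_label_def label_at_def
    by (intro semidec_ex semidec_decidable computable_intros)
  from semidec_comp[OF this, of "\<lambda>a. (f a, g a, h a)"] show ?thesis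
    using assms by (simp add: computable_Pair)
qed

lemma cyls_forces: "x \<in> cyls {\<sigma>. forces \<sigma> \<tau>} \<longleftrightarrow>
    (\<forall>i<length \<tau>. label (bit_column (node (nth0 \<tau>) i) x) (nth0 \<tau> i))"
proof
  assume "x \<in> cyls {\<sigma>. forces \<sigma> \<tau>}"
  then show "\<forall>i<length \<tau>. label (bit_column (node (nth0 \<tau>) i) x) (nth0 \<tau> i)"
    unfolding cyls_def forces_def label_column_iff by blast
next
  assume "\<forall>i<length \<tau>. label (bit_column (node (nth0 \<tau>) i) x) (nth0 \<tau> i)"
  then obtain l where l: "\<And>i. i < length \<tau> \<Longrightarrow>
      string_label (map x [0..<l i]) (node (nth0 \<tau>) i) (nth0 \<tau> i)"
    unfolding label_column_iff by metis
  define L where "L = Max (insert 0 (l ` {..<length \<tau>}))"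
  have "string_label (map x [0..<L]) (node (nth0 \<tau>) i) (nth0 \<tau> i)" if "i < length \<tau>" for i
  proof -
    have "l i \<le> L" using that unfolding L_def by (intro Max_ge) auto
    then have "map x [0..<L] = map x [0..<l i] @ map x [l i..<L]"
      by (metis le0 map_append upt_add_eq_append le_add_diff_inverse add_0)
    then show ?thesis using string_label_append[OF l[OF that]] by simp
  qed
  then show "x \<in> cyls {\<sigma>. forces \<sigma> \<tau>}" unfolding cyls_def forces_def by blast
qed

interpretation forces: string_map 2 3 forces
proof
  show "semidec (\<lambda>p. forces (fst p) (snd p))"
    unfolding forces_def
    by (intro semidec_all semidec_string_label computable_node computable_intros)
  fix \<sigma> \<tau> \<rho> :: "nat list"
  assume \<sigma>: "forces \<sigma> \<tau>"
  then show "forces (\<sigma> @ \<rho>) \<tau>"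
    unfolding forces_def using string_label_append by blast
  show "forces \<sigma> (take k \<tau>)" for k
  proof -
    have "node (nth0 (take k \<tau>)) i = node (nth0 \<tau>) i" if "i < length (take k \<tau>)" for i
      using that by (intro node_cong) simp
    then show ?thesis using \<sigma> unfolding forces_def by simp
  qed
  fix \<tau>' assume \<tau>': "forces \<sigma> \<tau>'" "length \<tau> = length \<tau>'"
  \<comment> \<open>If the digits before \<open>i\<close> agree, the same node is expanded at step
    \<open>i\<close>, and \<sigma> forces at most one label there.\<close>
  have "i < length \<tau> \<longrightarrow> nth0 \<tau> i = nth0 \<tau>' i" for i
  proof (induction i rule: less_induct)
    case (less i)
    show ?case
    proof
      assume i: "i < length \<tau>"
      then have "node (nth0 \<tau>) i = node (nth0 \<tau>') i"
        using less by (intro node_cong) simp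
      then have "string_label \<sigma> (node (nth0 \<tau>) i) (nth0 \<tau> i)" "string_label \<sigma> (node (nth0 \<tau>) i) (nth0 \<tau>' i)"
        using \<sigma> \<tau>' i unfolding forces_def by auto
      then show "nth0 \<tau> i = nth0 \<tau>' i"
        unfolding string_label_def using label_at_unique(2) by blast
    qed
  qed
  then show "\<tau> = \<tau>'" using \<tau>'(2) by (intro nth_equalityI) auto
next
  fix \<tau> :: "nat list" assume \<tau>: "set \<tau> \<subseteq> {..<3}"
  define N where "N = node (nth0 \<tau>)"
  have inj: "inj_on N A" for A
    unfolding N_def using strict_mono_node by (metis strict_mono_imp_inj_on)
  \<comment> \<open>\<open>measure_columns\<close> indexes its events by columns, whereas \<tau>
    lists labels by position; \<open>inv N\<close> recovers the position at which a column is
    read.\<close>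
  define A where "A q = {y. label y (nth0 \<tau> (inv N q))}" for q
  have inv: "inv N (N i) = i" for i using inj[of UNIV] by (rule inv_f_f)
  show "measure (unif 2) (cyls {\<sigma>. forces \<sigma> \<tau>}) = (1 / real 3) ^ length \<tau>"
  proof (cases "\<tau> = []")
    case True
    then have "cyls {\<sigma>. forces \<sigma> \<tau>} = UNIV" by (auto simp: cyls_def forces_def)
    then show ?thesis using True unif.prob_space[of 2] by simp
  next
    case False
    have "cyls {\<sigma>. forces \<sigma> \<tau>} = {x. \<forall>q\<in>N ` {..<length \<tau>}. bit_column q x \<in> A q}"
      using cyls_forces[of _ \<tau>] by (auto simp: A_def inv N_def[symmetric])
    also have "measure (unif 2) \<dots> = (\<Prod>q\<in>N ` {..<length \<tau>}. measure (unif 2) (A q))"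
      using False by (intro measure_columns) (auto simp: A_def)
    also have "\<dots> = (\<Prod>i<length \<tau>. measure (unif 2) (A (N i)))"
      by (rule prod.reindex_cong[OF inj]) auto
    also have "\<dots> = (\<Prod>i<length \<tau>. 1 / 3)"
    proof (intro prod.cong refl)
      fix i assume i: "i \<in> {..<length \<tau>}"
      then have "\<tau> ! i < 3" using \<tau> nth_mem by fastforce
      then show "measure (unif 2) (A (N i)) = 1 / 3"
        using measure_label i by (simp add: A_def inv)
    qed
    finally show ?thesis by simp
  qed
qed simp_all

text \<open>A column without repetition alternates forever. Alternation of its first
  \<open>i + 2\<close> bits leaves two words, of total measure \<open>2 * (1 / 2) ^ (i + 2)\<close>,
  so these events form a test. Hence the map from bits to codes is defined at every random
  point.\<close>

lemma random_column_repeats: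
  assumes "martin_loef_random 2 x"
  shows "\<exists>k. bit_column q x k = bit_column q x (Suc k)"
proof -
  define P where "P i \<sigma> \<longleftrightarrow> prod_encode (q, Suc i) < length (\<sigma> :: nat list) \<and>
    (\<forall>j<Suc i. nth0 \<sigma> (prod_encode (q, j)) \<noteq> nth0 \<sigma> (prod_encode (q, Suc j)))" for i \<sigma>
  define A where "A i = {y :: nat \<Rightarrow> nat. \<forall>j<Suc i. y j \<noteq> y (Suc j)}" for i :: nat
  have cyls: "cyls (Collect (P i)) = {x. bit_column q x \<in> A i}" for i
  proof -
    have nth: "nth0 (map x [0..<l]) (prod_encode (q, j)) = bit_column q x j"
      if "prod_encode (q, Suc i) < l" "j \<le> Suc i" for x l j
      using le_less_trans[OF prod_encode_mono[OF that(2)] that(1)] by (simp add: bit_column_def)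
    have "P i (map x [0..<l]) \<longleftrightarrow> prod_encode (q, Suc i) < l \<and> bit_column q x \<in> A i" for x l
      unfolding P_def A_def using nth[of l _ x] by (auto simp: less_Suc_eq_le)
    then show ?thesis
      unfolding cyls_def by (auto intro!: exI[of _ "Suc (prod_encode (q, Suc i))"])
  qed
  have A_sets: "A i \<in> sets (unif 2)" for i
  proof -
    have "{y \<in> space (unif 2). \<forall>j<Suc i. y j \<noteq> y (Suc j)} \<in> sets (unif 2)" by measurable
    then show ?thesis by (simp add: A_def)
  qed
  let ?B = "\<lambda>i b. {y. \<forall>j\<in>{..Suc i}. y j = (b + j) mod 2}"
  have "measure (unif 2) (A i) \<le> 1 / 2 ^ i" for i
  proof -
    have B: "?B i b \<in> sets (unif 2)" for b
    proof -
      have "{y \<in> space (unif 2). \<forall>j\<in>{..Suc i}. y j = (b + j) mod 2} \<in> sets (unif 2)" by measurable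
      then show ?thesis by simp
    qed
    have "A i \<inter> seqs 2 \<subseteq> ?B i 0 \<union> ?B i 1"
    proof
      fix y assume y: "y \<in> A i \<inter> seqs 2"
      then have "y \<in> ?B i (y 0)"
        using alternating_iff[of y "Suc i"] unfolding A_def atMost_iff Ball_def by blast
      moreover have "y 0 < 2" using y by (simp add: seqs_def)
      ultimately obtain b where "b = 0 \<or> b = 1" "y \<in> ?B i b"
        unfolding less_2_cases_iff One_nat_def by blast
      then show "y \<in> ?B i 0 \<union> ?B i 1" by blast
    qed
    then have "measure (unif 2) (A i \<inter> seqs 2) \<le> measure (unif 2) (?B i 0 \<union> ?B i 1)"
      by (rule unif.finite_measure_mono[OF _ sets.Un[OF B B]])
    also have "\<dots> \<le> measure (unif 2) (?B i 0) + measure (unif 2) (?B i 1)"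
      by (rule measure_Un_le[OF B B])
    also have "\<dots> = (1 / 2) ^ (i + 2) + (1 / 2) ^ (i + 2)"
      using measure_unif_coords[of "{..Suc i}" "\<lambda>j. (0 + j) mod 2" 2]
        measure_unif_coords[of "{..Suc i}" "\<lambda>j. (1 + j) mod 2" 2] by simp
    also have "\<dots> \<le> 1 / 2 ^ i" by (simp add: power_divide field_simps)
    finally show ?thesis using measure_Int_seqs[OF _ A_sets] by simp
  qed
  then have "measure (unif 2) (cyls (Collect (P i))) \<le> 1 / 2 ^ i" for i
    unfolding cyls using measure_columns[of "{q}" "\<lambda>_. A i" 2] A_sets by simp
  moreover have "semidec (\<lambda>p. P (fst p) (snd p))"
    unfolding P_def by (intro semidec_decidable computable_intros)
  ultimately have "test 2 P" by (simp add: test_def)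
  then obtain i where "x \<notin> cyls (Collect (P i))"
    using assms unfolding martin_loef_random_iff by blast
  then show ?thesis unfolding cyls A_def by auto
qed

section \<open>The induced map from bit sequences to codes of trees\<close>

definition labels_nodes :: "(nat \<Rightarrow> nat) \<Rightarrow> (nat \<Rightarrow> nat) \<Rightarrow> bool" where
  "labels_nodes x z \<longleftrightarrow> (\<forall>i. label (bit_column (node z i) x) (z i))"

lemma labels_nodes_iff: "labels_nodes x z \<longleftrightarrow> (\<forall>k. x \<in> cyls {\<sigma>. forces \<sigma> (map z [0..<k])})"
proof -
  have "node (nth0 (map z [0..<k])) i = node z i" if "i < k" for i k
    using that by (intro node_cong) simp
  then have "x \<in> cyls {\<sigma>. forces \<sigma> (map z [0..<k])} \<longleftrightarrow> (\<forall>i<k. label (bit_column (node z i) x) (z i))" for k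
    unfolding cyls_forces by simp
  then show ?thesis unfolding labels_nodes_def by auto
qed

lemma ex_labels_nodes:
  assumes "martin_loef_random 2 x"
  shows "\<exists>z\<in>seqs 3. labels_nodes x z"
proof -
  have "\<exists>d<3. label (bit_column q x) d" for q
    using random_column_repeats[OF assms] ex_label by metis
  then obtain l where l: "\<And>q. l q < 3" "\<And>q. label (bit_column q x) (l q)" by metis
  \<comment> \<open>The digit \<open>z i\<close> depends on node \<open>i\<close>, which depends on
    earlier digits. Building the queue directly from the labels \<open>l\<close> of all columns
    breaks the circle; \<open>z\<close> is read off afterwards.\<close>
  define Q where "Q = rec_nat [0] (\<lambda>i B. B @ kids_idx (l (B ! i)) (B ! i))"
  define z where "z i = l (Q i ! i)" for i
  have "bfs z i = Q i" for i
    by (induction i) (auto simp: Q_def z_def)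
  then have "node z i = Q i ! i" for i by (simp add: node_def)
  then have "labels_nodes x z" unfolding labels_nodes_def z_def using l by simp
  moreover have "z \<in> seqs 3" using l(1) by (simp add: seqs_def z_def)
  ultimately show ?thesis by blast
qed

lemma random_labels_nodes:
  assumes "martin_loef_random 2 x" "z \<in> seqs 3" "labels_nodes x z"
  shows "martin_loef_random 3 z"
  using assms forces.random_image unfolding labels_nodes_iff by blast

lemma ex_random_labels_nodes:
  assumes "martin_loef_random 3 z"
  shows "\<exists>x. martin_loef_random 2 x \<and> labels_nodes x z"
  using forces.random_preimage[OF assms] ex_labels_nodes unfolding labels_nodes_iff by blast

section \<open>Labels and binary values\<close>

definition binary_value :: "(nat \<Rightarrow> nat) \<Rightarrow> real" where
  "binary_value y = (\<Sum>k. real (y k) / 2 ^ Suc k)"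

lemma binary_value_summable:
  assumes "y \<in> seqs 2"
  shows "summable (\<lambda>k. real (y k) / 2 ^ Suc k)"
proof (rule summable_comparison_test'[of "\<lambda>k. (1 / 2) ^ Suc k" 0])
  show "summable (\<lambda>k. (1 / 2 :: real) ^ Suc k)" using power_half_series sums_summable by blast
  fix k
  have "y k \<le> 1" using assms by (simp add: seqs_def less_Suc_eq_le numeral_2_eq_2)
  then show "norm (real (y k) / 2 ^ Suc k) \<le> (1 / 2) ^ Suc k"
    by (simp add: power_divide divide_right_mono)
qed

lemma binary_value_bounds:
  assumes "y \<in> seqs 2"
  shows "0 \<le> binary_value y" "binary_value y \<le> 1"
proof -
  show "0 \<le> binary_value y"
    unfolding binary_value_def by (intro suminf_nonneg binary_value_summable assms) simp
  have le: "real (y k) / 2 ^ Suc k \<le> (1 / 2) ^ Suc k" for k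
  proof -
    have "y k \<le> 1" using assms by (simp add: seqs_def less_Suc_eq_le numeral_2_eq_2)
    then show ?thesis by (simp add: power_divide divide_right_mono)
  qed
  have "binary_value y \<le> (\<Sum>k. (1 / 2) ^ Suc k)"
    unfolding binary_value_def
    by (intro suminf_le le binary_value_summable assms sums_summable[OF power_half_series])
  also have "\<dots> = 1" using sums_unique[OF power_half_series] by simp
  finally show "binary_value y \<le> 1" .
qed

lemma binary_value_shift:
  assumes "y \<in> seqs 2"
  shows "binary_value y = (real (y 0) + binary_value (\<lambda>k. y (Suc k))) / 2"
proof -
  have sh: "(\<lambda>k. y (Suc k)) \<in> seqs 2" using assms by (simp add: seqs_def)
  have "binary_value y = (\<Sum>k. real (y (Suc k)) / 2 ^ Suc (Suc k)) + real (y 0) / 2"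
    unfolding binary_value_def using suminf_split_head[OF binary_value_summable[OF assms]] by simp
  also have "(\<Sum>k. real (y (Suc k)) / 2 ^ Suc (Suc k)) = (\<Sum>k. real (y (Suc k)) / 2 ^ Suc k / 2)"
    by (simp add: field_simps)
  also have "\<dots> = binary_value (\<lambda>k. y (Suc k)) / 2"
    unfolding binary_value_def using suminf_divide[OF binary_value_summable[OF sh], of 2] by simp
  finally show ?thesis by simp
qed

text \<open>Dropping the first bit exchanges the two thresholds: 1/3 is (0 + 2/3) / 2 and 2/3 is (1
  + 1/3) / 2. If the first two bits agree, the value is at most 1/4 or at least 3/4.\<close>

lemma binary_value_repeat:
  assumes "y \<in> seqs 2" "\<forall>j<k. y j \<noteq> y (Suc j)" "y k = y (Suc k)"
  shows "(y 0 = 0 \<longrightarrow> (if even k then binary_value y < 1 / 3 else 1 / 3 < binary_value y)) \<and>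
    (y 0 = 1 \<longrightarrow> (if even k then 2 / 3 < binary_value y else binary_value y < 2 / 3))"
  using assms
proof (induction k arbitrary: y)
  case 0
  have s: "(\<lambda>k. y (Suc k)) \<in> seqs 2" "(\<lambda>k. y (Suc (Suc k))) \<in> seqs 2"
    using 0 by (auto simp: seqs_def)
  have "binary_value y = 3 / 4 * real (y 0) + binary_value (\<lambda>k. y (Suc (Suc k))) / 4"
    using binary_value_shift[OF 0(1)] binary_value_shift[OF s(1)] 0(3) by (simp add: field_simps)
  then show ?case using binary_value_bounds[OF s(2)] by simp
next
  case (Suc k)
  let ?y = "\<lambda>k. y (Suc k)"
  have s: "?y \<in> seqs 2" using Suc.prems by (auto simp: seqs_def)
  have IH: "(?y 0 = 0 \<longrightarrow> (if even k then binary_value ?y < 1 / 3 else 1 / 3 < binary_value ?y)) \<and>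
    (?y 0 = 1 \<longrightarrow> (if even k then 2 / 3 < binary_value ?y else binary_value ?y < 2 / 3))"
    using Suc.prems s by (intro Suc.IH) auto
  have "y 0 < 2" "y 1 < 2" using Suc.prems(1) by (auto simp: seqs_def)
  moreover have "y 0 \<noteq> y 1" using Suc.prems(2) by auto
  ultimately have "y 0 = 0 \<and> y 1 = 1 \<or> y 0 = 1 \<and> y 1 = 0" by linarith
  then show ?case
    using IH binary_value_shift[OF Suc.prems(1)] by (auto simp: field_simps split: if_splits)
qed

lemma label_binary_value:
  assumes y: "y \<in> seqs 2" and "label y d"
  shows "1 / 3 < binary_value y \<longleftrightarrow> d \<noteq> 1" "1 / 3 < 1 - binary_value y \<longleftrightarrow> d \<noteq> 0"
proof -
  obtain k where k: "label_at y k d" using assms(2) unfolding label_def by blast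
  then obtain b where b: "b < 2" "d = (if even k then 1 - b else 2)"
    "\<forall>j\<in>{..Suc k}. y j = repeat_pattern b k j"
    unfolding label_at_iff_pattern[OF y] by blast
  have "y 0 = b" using b(1,3) by (auto simp: repeat_pattern_def)
  have rep: "(b = 0 \<longrightarrow> (if even k then binary_value y < 1 / 3 else 1 / 3 < binary_value y)) \<and>
    (b = 1 \<longrightarrow> (if even k then 2 / 3 < binary_value y else binary_value y < 2 / 3))"
    using binary_value_repeat[OF y, of k] k \<open>y 0 = b\<close> unfolding label_at_def by simp
  have s: "(\<lambda>k. y (Suc k)) \<in> seqs 2" using y by (auto simp: seqs_def)
  \<comment> \<open>For odd \<open>k\<close> the repetition excludes only one side of the middle
    interval; the other side is excluded by the first bit, which places the value on one side of
    1/2.\<close>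
  have half: "(b = 0 \<longrightarrow> binary_value y \<le> 1 / 2) \<and> (b = 1 \<longrightarrow> 1 / 2 \<le> binary_value y)"
    using binary_value_shift[OF y] binary_value_bounds[OF s] \<open>y 0 = b\<close> by auto
  have "b = 0 \<or> b = 1" using b(1) by linarith
  then show "1 / 3 < binary_value y \<longleftrightarrow> d \<noteq> 1" "1 / 3 < 1 - binary_value y \<longleftrightarrow> d \<noteq> 0"
    using rep half b(2) by (auto split: if_splits)
qed

section \<open>The tree of a code and the 1/3-support\<close>

lemma str_index_snoc: "str_index (\<sigma> @ [b]) = 2 * str_index \<sigma> + 1 + b"
proof -
  let ?S = "\<Sum>i<length \<sigma>. \<sigma> ! i * 2 ^ (length \<sigma> - Suc i)"
  have "(\<Sum>i<length \<sigma>. (\<sigma> @ [b]) ! i * 2 ^ (Suc (length \<sigma>) - Suc i)) = 2 * ?S"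
    unfolding sum_distrib_left
  proof (rule sum.cong)
    fix i assume "i \<in> {..<length \<sigma>}"
    then have "length \<sigma> - i = Suc (length \<sigma> - Suc i)" by auto
    then show "(\<sigma> @ [b]) ! i * 2 ^ (Suc (length \<sigma>) - Suc i) = 2 * (\<sigma> ! i * 2 ^ (length \<sigma> - Suc i))"
      using \<open>i \<in> {..<length \<sigma>}\<close> by (simp add: nth_append)
  qed simp
  then have "str_index (\<sigma> @ [b]) = 2 * ?S + b + 2 * 2 ^ length \<sigma> - 1"
    unfolding str_index_def by simp
  moreover have "(1::nat) \<le> 2 ^ length \<sigma>" by simp
  ultimately show ?thesis unfolding str_index_def by linarith
qed

lemma map_str_index_kids: "map str_index (kids d \<sigma>) = kids_idx d (str_index \<sigma>)"
  by (simp add: kids_def kids_idx_def str_index_snoc)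

text \<open>The link between the definition of \<open>tree3\<close> by levels and the queue: when
  all nodes of length below \<open>k\<close> have been expanded, the part of the queue still waiting
  is level \<open>k\<close>.\<close>

lemma lev_bfs: "drop (snd (lev z k)) (bfs z (snd (lev z k))) = map str_index (fst (lev z k))"
proof (induction k)
  case 0
  show ?case by (simp add: str_index_def)
next
  case (Suc k)
  obtain L off where L: "lev z k = (L, off)" by fastforce
  have IH: "drop off (bfs z off) = map str_index L" using Suc L by simp
  have len: "length (bfs z off) = off + length L"
    using arg_cong[OF IH, of length] length_bfs[of off z] by simp
  \<comment> \<open>Level \<open>k\<close> is expanded node by node. Its nodes were all in the queue
    beforehand, so the children appended meanwhile do not affect the entries being read.\<close>
  have "bfs z (off + j) = bfs z off @
      concat (map (\<lambda>j. kids_idx (z (off + j)) (str_index (L ! j))) [0..<j])" if "j \<le> length L" for j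
    using that
  proof (induction j)
    case (Suc j)
    have "bfs z (off + j) ! (off + j) = bfs z off ! (off + j)"
      using nth_bfs[of off "off + j" "off + j" z] len Suc.prems by simp
    also have "\<dots> = drop off (bfs z off) ! j" using len by simp
    also have "\<dots> = str_index (L ! j)" using IH Suc.prems by simp
    finally show ?case using Suc by simp
  qed simp
  from this[of "length L"] show ?case
    using L len by (simp add: map_concat comp_def map_str_index_kids)
qed

lemma node_lev:
  assumes "lev z k = (L, off)" "j < length L"
  shows "node z (off + j) = str_index (L ! j)"
proof -
  have IH: "drop off (bfs z off) = map str_index L" using lev_bfs[of z k] assms(1) by simp
  have len: "length (bfs z off) = off + length L"
    using arg_cong[OF IH, of length] length_bfs[of off z] by simp
  have "node z (off + j) = bfs z off ! (off + j)"
    unfolding node_def using nth_bfs[of off "off + j" "off + j" z] len assms(2) by simp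
  also have "\<dots> = drop off (bfs z off) ! j" using len by simp
  finally show ?thesis using IH assms(2) by simp
qed

definition admits :: "nat \<Rightarrow> nat \<Rightarrow> bool" where
  "admits d b \<longleftrightarrow> b = 0 \<and> d \<noteq> 1 \<or> b = 1 \<and> d \<noteq> 0"

lemma snoc_in_kids: "\<sigma> @ [b] \<in> set (kids d \<rho>) \<longleftrightarrow> \<sigma> = \<rho> \<and> admits d b"
  by (auto simp: kids_def admits_def)

lemma lev_Suc: "lev z k = (L, off) \<Longrightarrow>
    \<sigma> \<in> set (fst (lev z (Suc k))) \<longleftrightarrow> (\<exists>j<length L. \<sigma> \<in> set (kids (z (off + j)) (L ! j)))"
  by auto

lemma length_lev: "\<sigma> \<in> set (fst (lev z k)) \<Longrightarrow> length \<sigma> = k"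
proof (induction k arbitrary: \<sigma>)
  case (Suc k)
  obtain L off where L: "lev z k = (L, off)" by fastforce
  obtain j where j: "j < length L" "\<sigma> \<in> set (kids (z (off + j)) (L ! j))"
    using Suc.prems unfolding lev_Suc[OF L] by blast
  moreover have "length (L ! j) = k" using Suc.IH L j(1) by simp
  ultimately show ?case by (auto simp: kids_def split: if_splits)
qed simp

lemma tree3_iff: "\<sigma> \<in> tree3 z \<longleftrightarrow> \<sigma> \<in> set (fst (lev z (length \<sigma>)))"
  unfolding tree3_def using length_lev by blast

text \<open>The position of \<sigma> in the breadth-first order disappears: the digit of
  \<open>z\<close> at that position is the label of the column numbered
  \<open>str_index \<sigma>\<close>, and labels are unique. The tree can thus be compared with
  \<open>T_meas\<close> node by node.\<close>

lemma tree3_snoc: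
  assumes "labels_nodes x z"
  shows "\<sigma> @ [b] \<in> tree3 z \<longleftrightarrow>
    \<sigma> \<in> tree3 z \<and> (\<exists>d. label (bit_column (str_index \<sigma>) x) d \<and> admits d b)"
proof -
  obtain L off where L: "lev z (length \<sigma>) = (L, off)" by fastforce
  have lab: "label (bit_column (str_index (L ! j)) x) (z (off + j))" if "j < length L" for j
    using assms node_lev[OF L that] unfolding labels_nodes_def by metis
  have "\<sigma> @ [b] \<in> tree3 z \<longleftrightarrow> (\<exists>j<length L. \<sigma> = L ! j \<and> admits (z (off + j)) b)"
    unfolding tree3_iff using lev_Suc[OF L] snoc_in_kids by simp
  also have "\<dots> \<longleftrightarrow> \<sigma> \<in> set L \<and> (\<exists>d. label (bit_column (str_index \<sigma>) x) d \<and> admits d b)"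
    using lab label_unique by (metis in_set_conv_nth)
  finally show ?thesis unfolding tree3_iff using L by simp
qed

lemma labels_tree3:
  assumes "labels_nodes x z" "\<sigma> \<in> tree3 z"
  shows "\<exists>d. label (bit_column (str_index \<sigma>) x) d"
proof -
  obtain L off where L: "lev z (length \<sigma>) = (L, off)" by fastforce
  then obtain j where "j < length L" "\<sigma> = L ! j"
    using assms(2) unfolding tree3_iff by (auto simp: in_set_conv_nth)
  then show ?thesis using assms(1) node_lev[OF L] unfolding labels_nodes_def by metis
qed

lemma mu_snoc: "mu x (\<sigma> @ [b]) =
    mu x \<sigma> * (if b = 0 then col x (str_index \<sigma>) else 1 - col x (str_index \<sigma>))"
  by (simp add: mu_def nth_append Let_def)

lemma T_meas_snoc:
  "\<sigma> @ [b] \<in> T_meas m \<longleftrightarrow> \<sigma> \<in> T_meas m \<and> b < 2 \<and> 1 / 3 < cond m (\<sigma> @ [b]) \<sigma>"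
  by (auto simp: T_meas_def binstr_def less_Suc_eq all_conj_distrib)

text \<open>Each step along \<open>T_meas\<close> keeps more than a third of the mass, so the mass
  stays positive. The factor \<open>m \<sigma>\<close> can then be cancelled in the conditional
  measures.\<close>

lemma T_meas_pos:
  assumes "m [] > 0"
  shows "\<sigma> \<in> T_meas m \<Longrightarrow> 0 < m \<sigma>"
proof (induction \<sigma> rule: rev_induct)
  case (snoc b \<sigma>)
  then have "0 < m \<sigma>" "1 / 3 < m (\<sigma> @ [b]) / m \<sigma>"
    by (auto simp: T_meas_snoc cond_def)
  then show ?case by (simp add: field_simps)
qed (use assms in simp)

lemma tree3_eq_T_meas:
  assumes x: "x \<in> seqs 2" and "labels_nodes x z"
  shows "\<sigma> \<in> tree3 z \<longleftrightarrow> \<sigma> \<in> T_meas (mu x)"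
proof (induction \<sigma> rule: rev_induct)
  case Nil
  show ?case by (simp add: tree3_iff T_meas_def)
next
  case (snoc b \<sigma>)
  let ?y = "bit_column (str_index \<sigma>) x"
  \<comment> \<open>The comparison is made at nodes of the tree, where the column has a label and
    \<open>mu x \<sigma>\<close> is positive.\<close>
  have "(\<exists>d. label ?y d \<and> admits d b) \<longleftrightarrow> b < 2 \<and> 1 / 3 < cond (mu x) (\<sigma> @ [b]) \<sigma>"
    if \<sigma>: "\<sigma> \<in> tree3 z"
  proof -
    obtain d where d: "label ?y d" using labels_tree3[OF assms(2) \<sigma>] by blast
    have "mu x [] > 0" by (simp add: mu_def)
    moreover have "\<sigma> \<in> T_meas (mu x)" using snoc \<sigma> by blast
    ultimately have "0 < mu x \<sigma>" by (rule T_meas_pos)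
    then have "cond (mu x) (\<sigma> @ [b]) \<sigma> = (if b = 0 then binary_value ?y else 1 - binary_value ?y)"
      by (simp add: cond_def mu_snoc col_def binary_value_def bit_column_def)
    moreover have "?y \<in> seqs 2" using x by (simp add: seqs_def bit_column_def)
    ultimately have "(b < 2 \<and> 1 / 3 < cond (mu x) (\<sigma> @ [b]) \<sigma>) \<longleftrightarrow> admits d b"
      using label_binary_value[of ?y d] d by (auto simp: admits_def less_2_cases_iff)
    then show ?thesis using d label_unique by metis
  qed
  then show ?case unfolding tree3_snoc[OF assms(2)] T_meas_snoc using snoc by blast
qed

lemma paths_tree3_eq_third_support:
  assumes "x \<in> seqs 2" "labels_nodes x z"
  shows "paths (tree3 z) = third_support (mu x)"
proof -
  have "tree3 z = T_meas (mu x)" using tree3_eq_T_meas[OF assms] by blast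
  then show ?thesis unfolding third_support_def by simp
qed

theorem theorem5p3:
  fixes C :: "(nat \<Rightarrow> nat) set"
  assumes "closed C" and "C \<noteq> {}" and "C \<subseteq> seqs 2"
  shows "random_closed C \<longleftrightarrow> random_measure_support C"
proof
  assume "random_closed C"
  then obtain z where z: "martin_loef_random 3 z" "C = paths (tree3 z)"
    unfolding random_closed_def by blast
  obtain x where x: "martin_loef_random 2 x" "labels_nodes x z"
    using ex_random_labels_nodes[OF z(1)] by blast
  then have "C = third_support (mu x)"
    using z(2) paths_tree3_eq_third_support by (simp add: martin_loef_random_def)
  with x(1) show "random_measure_support C" unfolding random_measure_support_def by blast
next
  assume "random_measure_support C"
  then obtain x where x: "martin_loef_random 2 x" "C = third_support (mu x)"
    unfolding random_measure_support_def by blast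
  obtain z where z: "z \<in> seqs 3" "labels_nodes x z"
    using ex_labels_nodes[OF x(1)] by blast
  then have "C = paths (tree3 z)"
    using x paths_tree3_eq_third_support[of x z] by (simp add: martin_loef_random_def)
  with random_labels_nodes[OF x(1) z] show "random_closed C" unfolding random_closed_def by blast
qed

end
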